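(* Let $\zeta(s)$ be the Riemann zeta function, $\xi(s)=\frac{1}{2}s(s-1)\pi^{-s/2}\Gamma(\frac{s}{2})\zeta(s)$ the Riemann $\xi$-function, and $\lambda(t)=\xi(\frac{1}{2}+it)$ for real $t$. For $s\in\mathbb{C}$ with $\Re(s)>1$, define $$\Upsilon(s):=\left(s-\tfrac{1}{2}\right)\int_{0}^{\infty}\frac{\lambda(t)}{(t^2+\frac{1}{4})\left(t^2+(s-\frac{1}{2})^2\right)}\,dt.$$ Then for $\Re(s)>1$, $$\Upsilon(s)=\frac{\pi}{2}\left(\frac{1}{s-1}-\frac{2\xi(s)}{s(s-1)}+\pi^{-s/2}\sum_{n\ge1}n^{-s}\,\Gamma\!\left(\frac{s}{2},\pi n^2\right)\right).$$
   Context: $\Gamma(s,x)=\int_x^\infty u^{s-1}e^{-u}\,du$ denotes the upper incomplete gamma function. *)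

theory Defs
  imports "HOL-Complex_Analysis.Complex_Analysis"
begin

(* zeta is the holomorphic continuation of the Dirichlet series to the plane without 1. By the
   identity theorem the values of the chosen f on that connected set do not depend on the choice;
   the value at the pole is set to 0, as usual in HOL. *)
definition riemann_zeta :: "complex \<Rightarrow> complex" where
  "riemann_zeta s =
     (if s = 1 then 0
      else (SOME f. f holomorphic_on (- {1}) \<and>
                    (\<forall>z. Re z > 1 \<longrightarrow> f z = (\<Sum>n. of_nat (Suc n) powr (- z)))) s)"

(* The formula has removable singularities at 1, 0, -2, -4, ..., where the HOL conventions for poles
   make it 0 instead of the value of the entire function. None of these points lies
   on the line Re s = 1/2 or in the half-plane Re s > 1. *)
definition riemann_xi :: "complex \<Rightarrow> complex" where
  "riemann_xi s = 1 / 2 * s * (s - 1) * of_real pi powr (- s / 2) * Gamma (s / 2) * riemann_zeta s"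

definition riemann_lambda :: "real \<Rightarrow> complex" where
  "riemann_lambda t = riemann_xi (1 / 2 + \<i> * of_real t)"

definition upper_Gamma :: "complex \<Rightarrow> real \<Rightarrow> complex" where
  "upper_Gamma s x = (LBINT u:{x..}. of_real u powr (s - 1) * of_real (exp (- u)))"

definition Upsilon :: "complex \<Rightarrow> complex" where
  "Upsilon s =
     (s - 1 / 2) *
     (LBINT t:{0..}. riemann_lambda t /
        ((of_real t ^ 2 + 1 / 4) * (of_real t ^ 2 + (s - 1 / 2) ^ 2)))"

end

theory Submission
  imports Defs "HOL-Probability.Characteristic_Functions" "HOL-Probability.Sinc_Integral"
    "HOL-Real_Asymp.Real_Asymp"
begin

text \<open>
  Let \<open>\<omega>(x)\<close> be the sum of \<open>exp (- \<pi> n\<^sup>2 x)\<close> over \<open>n \<ge> 1\<close>, put \<open>w y = \<omega> (exp (2 y))\<close>, and let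
  \<open>M s\<close> be the integral of \<open>w y exp (s y)\<close> over \<open>y \<ge> 0\<close>, an entire function of \<open>s\<close>. The
  functional equation of \<open>\<omega>\<close> gives Riemann's formula
  \<open>2 \<xi>(s) / (s (s - 1)) = 1 / (s - 1) - 1 / s + 2 M s + 2 M (1 - s)\<close>, and \<open>2 M s\<close> is the sum over
  the incomplete gamma functions. On the critical line the formula expresses
  \<open>\<lambda>(t) / (t\<^sup>2 + 1 / 4)\<close> through the cosine transform of \<open>w y exp (y / 2)\<close>. By Fubini and
  \<open>\<integral> cos (t y) / (t\<^sup>2 + a\<^sup>2) dt = \<pi> / (2 a) exp (- a y)\<close> over \<open>t \<ge> 0\<close>, with \<open>a = s - 1 / 2\<close>, both
  sides of the claim are equal to \<open>\<pi> / 2 (1 / s - 2 M (1 - s))\<close>.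
\<close>

section \<open>The functional equation of the theta series\<close>

text \<open>The functional equation of \<open>omega\<close> is Poisson summation for a Gaussian. By
  evenness it can be read on half a period: both sides become continuous functions on
  \<open>[0, 1/2]\<close>, and equality of all cosine coefficients is enough, so no pointwise
  convergence theorem for Fourier series enters. The coefficients are values of the characteristic
  function of the normal distribution.

  Zeta is a choice among the continuations of the Dirichlet series, so nothing can be said about it
  before one continuation is exhibited. Riemann's formula, solved for zeta, is that witness. It
  needs \<open>omega_mellin\<close> on the whole plane, because \<open>1 - s\<close> lies in the
  left half-plane when \<open>Re s > 1\<close>.

  The parameter \<open>a\<close> is complex, so t^2 + a^2 is in general neither real nor positive
  for real t. This is why complex logarithms, a half-disc contour and explicit lower bounds for the
  modulus take the place of the arctangent.\<close>

lemma sums_integral_M_test: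
  fixes f :: "nat \<Rightarrow> real \<Rightarrow> real"
  assumes cont: "\<And>n. continuous_on {a..b} (f n)"
    and bound: "\<And>n u. u \<in> {a..b} \<Longrightarrow> \<bar>f n u\<bar> \<le> M n"
    and M: "summable M"
  shows "continuous_on {a..b} (\<lambda>u. \<Sum>n. f n u)"
    and "(\<lambda>n. integral {a..b} (f n)) sums integral {a..b} (\<lambda>u. \<Sum>n. f n u)"
proof -
  have u: "uniform_limit {a..b} (\<lambda>n u. \<Sum>i<n. f i u) (\<lambda>u. \<Sum>i. f i u) sequentially"
    using bound M by (intro Weierstrass_m_test) auto
  have c: "continuous_on {a..b} (\<lambda>u. \<Sum>i<n. f i u)" for n
    by (intro continuous_on_sum cont)
  show "continuous_on {a..b} (\<lambda>u. \<Sum>n. f n u)"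
    by (rule uniform_limit_theorem[OF _ u]) (use c in auto)
  obtain I J where I: "\<And>n. ((\<lambda>u. \<Sum>i<n. f i u) has_integral I n) {a..b}"
    and J: "((\<lambda>u. \<Sum>i. f i u) has_integral J) {a..b}" and lim: "I \<longlonglongrightarrow> J"
    using uniform_limit_integral[OF u c] by auto
  have "I n = (\<Sum>i<n. integral {a..b} (f i))" for n
    using I[of n] by (subst integral_sum[symmetric])
      (auto intro!: integrable_continuous_real cont dest: integral_unique)
  then have "I = (\<lambda>n. \<Sum>i<n. integral {a..b} (f i))" by (rule ext)
  then show "(\<lambda>n. integral {a..b} (f n)) sums integral {a..b} (\<lambda>u. \<Sum>n. f n u)"
    using lim by (simp add: sums_def integral_unique[OF J])
qed

text \<open>A function of \<open>cos (2 * pi * u)\<close> is a uniform limit of polynomials in it, hence \<open>h\<close> is orthogonal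
  to itself.\<close>

lemma cosine_coefficients_zero_imp_zero:
  fixes h :: "real \<Rightarrow> real"
  assumes cont: "continuous_on {0..1/2} h"
    and coeff: "\<And>k::nat. integral {0..1/2} (\<lambda>u. h u * cos (2 * pi * real k * u)) = 0"
    and u: "u \<in> {0..1/2}"
  shows "h u = 0"
proof -
  have pow: "integral {0..1/2} (\<lambda>u. h u * cos (2 * pi * u) ^ j * cos (2 * pi * real k * u)) = 0" for j k
  proof (induction j arbitrary: k)
    case 0 
    then show ?case using coeff by simp
  next
    case (Suc j)
    \<comment> \<open>The product formula lowers the frequency to |k - 1|: evenness of the cosine
      turns -1 into 1, so natural frequencies suffice for the induction.\<close>
    define l where "l = (if k = 0 then 1 else k - 1)"
    have c2: "cos (2 * pi * u) * cos (2 * pi * real k * u) =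
          1/2 * (cos (2 * pi * real (Suc k) * u) + cos (2 * pi * real l * u))" for u
    proof (cases "k = 0")
      case False
      then have "real l = real k - 1" by (simp add: l_def of_nat_diff)
      then have "2 * pi * real l * u = 2 * pi * real k * u - 2 * pi * u"
        and "2 * pi * real (Suc k) * u = 2 * pi * real k * u + 2 * pi * u"
        unfolding \<open>real l = real k - 1\<close> by (simp_all add: algebra_simps)
      then show ?thesis by (simp only: cos_add cos_diff) simp
    qed (simp add: l_def)
    have eq: "h u * cos (2 * pi * u) ^ Suc j * cos (2 * pi * real k * u) =
       1/2 * (h u * cos (2 * pi * u) ^ j * cos (2 * pi * real (Suc k) * u)) +
       1/2 * (h u * cos (2 * pi * u) ^ j * cos (2 * pi * real l * u))" for u
      using arg_cong[OF c2, of "\<lambda>x. h u * cos (2 * pi * u) ^ j * x" u] by (simp add: algebra_simps)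
    have "integral {0..1/2} (\<lambda>u. h u * cos (2 * pi * u) ^ Suc j * cos (2 * pi * real k * u)) =
       1/2 * integral {0..1/2} (\<lambda>u. h u * cos (2 * pi * u) ^ j * cos (2 * pi * real (Suc k) * u)) +
       1/2 * integral {0..1/2} (\<lambda>u. h u * cos (2 * pi * u) ^ j * cos (2 * pi * real l * u))"
      unfolding eq
      by (subst Henstock_Kurzweil_Integration.integral_add)
        (auto intro!: integrable_continuous_real continuous_intros cont)
    also have "\<dots> = 0" unfolding Suc.IH by simp
    finally show ?case .
  qed
  have poly: "integral {0..1/2} (\<lambda>u. h u * p (cos (2 * pi * u))) = 0"
    if p: "real_polynomial_function p" for p
  proof -
    obtain a n where p_eq: "p = (\<lambda>x. \<Sum>i\<le>n::nat. a i * x ^ i)"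
      using p by (auto simp: real_polynomial_function_iff_sum)
    have "integral {0..1/2} (\<lambda>u. h u * p (cos (2 * pi * u))) =
          integral {0..1/2} (\<lambda>u. \<Sum>i\<le>n. a i * (h u * cos (2 * pi * u) ^ i * cos (2 * pi * real 0 * u)))"
      by (simp add: p_eq sum_distrib_left algebra_simps)
    also have "\<dots> = (\<Sum>i\<le>n. a i * integral {0..1/2} (\<lambda>u. h u * cos (2 * pi * u) ^ i * cos (2 * pi * real 0 * u)))"
      by (subst integral_sum)
        (auto intro!: integrable_continuous_real continuous_intros cont)
    also have "\<dots> = 0" unfolding pow by simp
    finally show ?thesis .
  qed
  \<comment> \<open>The map \<open>u \<mapsto> cos (2 * pi * u)\<close> is a bijection from
    \<open>[0, 1/2]\<close> onto \<open>[-1, 1]\<close>, which is why half a period is used;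
    \<open>H\<close> is \<open>h\<close> in the new variable.\<close>
  define H where "H = (\<lambda>z. h (arccos z / (2 * pi)))"
  have contH: "continuous_on {-1..1} H"
    unfolding H_def
  proof (rule continuous_on_compose2[OF cont])
    show "continuous_on {-1..1} (\<lambda>z. arccos z / (2 * pi))"
      by (intro continuous_intros) auto
    show "(\<lambda>z. arccos z / (2 * pi)) ` {-1..1} \<subseteq> {0..1/2}"
      using arccos_lbound arccos_ubound by (auto simp: field_simps)
  qed
  have H: "H (cos (2 * pi * u)) = h u" if "u \<in> {0..1/2}" for u
    using that unfolding H_def by (subst arccos_cos) (auto simp: field_simps)
  define A where "A = integral {0..1/2} (\<lambda>u. \<bar>h u\<bar>)"
  have A: "A \<ge> 0" unfolding A_def
    by (intro Henstock_Kurzweil_Integration.integral_nonneg integrable_continuous_real continuous_intros cont) auto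
  have small: "integral {0..1/2} (\<lambda>u. h u * h u) \<le> e * A" if e: "e > 0" for e
  proof -
    obtain p where p: "real_polynomial_function p" and ap: "\<And>x. x \<in> {-1..1} \<Longrightarrow> \<bar>H x - p x\<bar> < e"
      using Stone_Weierstrass_real_polynomial_function[of "{-1..1::real}" H e] contH e by auto
    have contp: "continuous_on {0..1/2} (\<lambda>u. p (cos (2 * pi * u)))"
      using p by (auto simp: real_polynomial_function_iff_sum intro!: continuous_intros)
    have "integral {0..1/2} (\<lambda>u. h u * h u) =
      integral {0..1/2} (\<lambda>u. h u * (h u - p (cos (2 * pi * u)))) + integral {0..1/2} (\<lambda>u. h u * p (cos (2 * pi * u)))"
      by (subst Henstock_Kurzweil_Integration.integral_add[symmetric])
        (auto intro!: integrable_continuous_real continuous_intros cont contp simp: right_diff_distrib)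
    also have "\<dots> = integral {0..1/2} (\<lambda>u. h u * (h u - p (cos (2 * pi * u))))"
      using poly[OF p] by simp
    also have "\<dots> \<le> integral {0..1/2} (\<lambda>u. e * \<bar>h u\<bar>)"
    proof (rule integral_le)
      fix u :: real assume u: "u \<in> {0..1/2}"
      have "\<bar>h u - p (cos (2 * pi * u))\<bar> \<le> e"
        using ap[of "cos (2 * pi * u)"] H[OF u] by simp
      then have "\<bar>h u\<bar> * \<bar>h u - p (cos (2 * pi * u))\<bar> \<le> \<bar>h u\<bar> * e"
        by (intro mult_left_mono) auto
      then show "h u * (h u - p (cos (2 * pi * u))) \<le> e * \<bar>h u\<bar>"
        by (metis abs_le_D1 abs_mult mult.commute)
    qed (auto intro!: integrable_continuous_real continuous_intros cont contp)
    also have "\<dots> = e * A" unfolding A_def by simp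
    finally show ?thesis .
  qed
  have "integral {0..1/2} (\<lambda>u. h u * h u) \<le> 0"
  proof (rule field_le_epsilon)
    fix e :: real assume e: "e > 0"
    \<comment> \<open>\<open>A\<close> may vanish, hence the denominator
      \<open>A + 1\<close>.\<close>
    have "integral {0..1/2} (\<lambda>u. h u * h u) \<le> e / (A + 1) * A"
      using e A by (intro small) auto
    also have "\<dots> \<le> e"
      using e A by (simp add: field_simps)
    finally show "integral {0..1/2} (\<lambda>u. h u * h u) \<le> 0 + e" by simp
  qed
  moreover have "integral {0..1/2} (\<lambda>u. h u * h u) \<ge> 0"
    by (intro Henstock_Kurzweil_Integration.integral_nonneg integrable_continuous_real continuous_intros cont) auto
  ultimately have "integral {0..1/2} (\<lambda>u. h u * h u) = 0" by linarith
  then have "\<forall>u\<in>{0..1/2}. h u * h u = 0"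
    by (subst (asm) integral_eq_0_iff) (auto intro!: continuous_intros cont)
  with u show ?thesis by auto
qed

lemma integral_Icc_cos_cos:
  "integral {0..1/2} (\<lambda>u. cos (2 * pi * real k * u) * cos (2 * pi * real m * u)) =
    (if k \<noteq> m then 0 else if k = 0 then 1/2 else 1/4)"
proof -
  \<comment> \<open>Integer frequencies, because the product formula produces the possibly negative
    difference of \<open>k\<close> and \<open>m\<close>.\<close>
  have *: "((\<lambda>u. cos (2 * pi * of_int k * u)) has_integral (if k = 0 then 1/2 else 0)) {0..1/2}" for k :: int
  proof (cases "k = 0")
    case True
    then show ?thesis using has_integral_const_real[of "1::real" 0 "1/2"] by simp
  next
    case False
    have "((\<lambda>u. cos (2 * pi * of_int k * u)) has_integral
        (sin (2 * pi * of_int k * (1/2)) / (2 * pi * of_int k) - sin (2 * pi * of_int k * 0) / (2 * pi * of_int k))) {0..1/2}"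
      using False by (intro fundamental_theorem_of_calculus)
       (auto intro!: derivative_eq_intros simp flip: has_real_derivative_iff_has_vector_derivative)
    moreover have "sin (2 * pi * of_int k * (1/2)) = 0" by (simp add: sin_zero_iff_int2)
    ultimately show ?thesis using False by simp
  qed
  have "((\<lambda>u. 1/2 * (cos (2 * pi * of_int (int k - int m) * u) + cos (2 * pi * of_int (int k + int m) * u))) has_integral
     1/2 * ((if int k - int m = 0 then 1/2 else 0) + (if int k + int m = 0 then 1/2 else 0))) {0..1/2}"
    by (intro has_integral_mult_right has_integral_add *)
  also have "(\<lambda>u. 1/2 * (cos (2 * pi * of_int (int k - int m) * u) + cos (2 * pi * of_int (int k + int m) * u))) =
     (\<lambda>u. cos (2 * pi * real k * u) * cos (2 * pi * real m * u))"
    by (auto simp: fun_eq_iff cos_times_cos algebra_simps)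
  finally show ?thesis by (auto dest!: integral_unique)
qed

section \<open>The cosine transform of the Gaussian\<close>

text \<open>This is the characteristic function of the standard normal distribution under the
  substitution u = sqrt (2 pi x) v. The parameter \<open>t\<close> is chosen so that t u = 2 pi c v;
  normalisation and Jacobian together leave 1 / sqrt x.\<close>

lemma gaussian_cos_has_integral:
  fixes x c :: real
  assumes x: "x > 0"
  shows "has_bochner_integral lborel (\<lambda>v. exp (- (pi * x * v\<^sup>2)) * cos (2 * pi * c * v)) (exp (- (pi * c\<^sup>2 / x)) / sqrt x)"
proof -
  define t where "t = 2 * pi * c / sqrt (2 * pi * x)"
  have t2: "t\<^sup>2 / 2 = pi * c\<^sup>2 / x"
    using x by (simp add: t_def power_divide power_mult_distrib power2_eq_square)
  have s: "prob_space std_normal_distribution"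
    by (rule prob_space_normal_density) simp
  have i: "integrable std_normal_distribution (\<lambda>u. cos (t * u))"
  proof -
    interpret prob_space std_normal_distribution by fact
    show ?thesis by (rule integrable_const_bound[where B=1]) auto
  qed
  have ii: "integrable std_normal_distribution (\<lambda>u. iexp (t * u))"
  proof -
    interpret prob_space std_normal_distribution by fact
    show ?thesis by (rule integrable_const_bound[where B=1]) auto
  qed
  have "(CLINT u|std_normal_distribution. iexp (t * u)) = of_real (exp (- (t\<^sup>2) / 2))"
    using char_std_normal_distribution by (metis char_def)
  then have "Re (CLINT u|std_normal_distribution. iexp (t * u)) = exp (- (t\<^sup>2) / 2)" by simp
  also have "Re (CLINT u|std_normal_distribution. iexp (t * u)) = (LINT u|std_normal_distribution. cos (t * u))"
    by (subst integral_Re[symmetric, OF ii]) (simp add: Re_exp)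
  finally have "has_bochner_integral std_normal_distribution (\<lambda>u. cos (t * u)) (exp (- (t\<^sup>2) / 2))"
    using i by (simp add: has_bochner_integral_iff)
  then have "has_bochner_integral lborel (\<lambda>u. std_normal_density u *\<^sub>R cos (t * u)) (exp (- (t\<^sup>2) / 2))"
    by (auto simp: has_bochner_integral_iff integrable_density integral_density)
  then have "has_bochner_integral lborel (\<lambda>v. std_normal_density (0 + sqrt (2 * pi * x) * v) *\<^sub>R cos (t * (0 + sqrt (2 * pi * x) * v)))
       (exp (- (t\<^sup>2) / 2) /\<^sub>R \<bar>sqrt (2 * pi * x)\<bar>)"
    using x by (subst (asm) lborel_has_bochner_integral_real_affine_iff[of "sqrt (2 * pi * x)" _ _ 0]) auto
  then have "has_bochner_integral lborel (\<lambda>v. sqrt (2 * pi) * (std_normal_density (0 + sqrt (2 * pi * x) * v) *\<^sub>R cos (t * (0 + sqrt (2 * pi * x) * v))))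
       (sqrt (2 * pi) * (exp (- (t\<^sup>2) / 2) /\<^sub>R \<bar>sqrt (2 * pi * x)\<bar>))"
    by (rule has_bochner_integral_mult_right)
  also have "(\<lambda>v. sqrt (2 * pi) * (std_normal_density (0 + sqrt (2 * pi * x) * v) *\<^sub>R cos (t * (0 + sqrt (2 * pi * x) * v)))) = (\<lambda>v. exp (- (pi * x * v\<^sup>2)) * cos (2 * pi * c * v))"
    using x by (auto simp: fun_eq_iff std_normal_density_def t_def power_mult_distrib mult_ac)
  also have "sqrt (2 * pi) * (exp (- (t\<^sup>2) / 2) /\<^sub>R \<bar>sqrt (2 * pi * x)\<bar>) = exp (- (pi * c\<^sup>2 / x)) / sqrt x"
    using x t2 by (simp add: real_sqrt_mult field_simps)
  finally show ?thesis .
qed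

text \<open>Half of the value over the line, by evenness. The endpoints are integers so that the
  limit can be compared with partial sums over unit intervals.\<close>

lemma gaussian_cos_half_line:
  fixes x c :: real
  assumes x: "x > 0"
  shows "((\<lambda>N. integral {0..real N} (\<lambda>v. exp (- (pi * x * v\<^sup>2)) * cos (2 * pi * c * v))) \<longlongrightarrow> exp (- (pi * c\<^sup>2 / x)) / (2 * sqrt x)) sequentially"
proof -
  let ?f = "\<lambda>v. exp (- (pi * x * v\<^sup>2)) * cos (2 * pi * c * v)"
  have hb: "has_bochner_integral lborel ?f (exp (- (pi * c\<^sup>2 / x)) / sqrt x)"
    by (rule gaussian_cos_has_integral[OF x])
  have cont: "continuous_on S ?f" for S by (intro continuous_intros)
  have "((\<lambda>N. LBINT v. indicator {- real N..real N} v *\<^sub>R ?f v) \<longlongrightarrow> (LBINT v. ?f v)) sequentially"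
  proof (rule integral_dominated_convergence)
    show "integrable lborel (\<lambda>v. norm (?f v))" using hb by (auto simp: has_bochner_integral_iff)
    show "AE v in lborel. (\<lambda>N. indicator {- real N..real N} v *\<^sub>R ?f v) \<longlonglongrightarrow> ?f v"
    proof (rule AE_I2)
      fix v :: real
      obtain m where m: "\<bar>v\<bar> \<le> real m" using real_arch_simple by blast
      have "eventually (\<lambda>N. indicator {- real N..real N} v *\<^sub>R ?f v = ?f v) sequentially"
        using eventually_ge_at_top[of m] by eventually_elim (use m in \<open>auto simp: indicator_def\<close>)
      then show "(\<lambda>N. indicator {- real N..real N} v *\<^sub>R ?f v) \<longlonglongrightarrow> ?f v"
        by (rule tendsto_eventually)
    qed
  qed (auto simp: indicator_def)
  moreover have "(LBINT v. indicator {- real N..real N} v *\<^sub>R ?f v) = 2 * integral {0..real N} ?f" for N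
  proof -
    have "set_integrable lborel {- real N..real N} ?f"
      unfolding set_integrable_def using hb
      by (intro integrable_mult_indicator) (auto simp: has_bochner_integral_iff)
    then have "(LBINT v. indicator {- real N..real N} v *\<^sub>R ?f v) = integral {- real N..real N} ?f"
      using set_borel_integral_eq_integral(2) by (simp only: set_lebesgue_integral_def)
    also have "\<dots> = integral {- real N..0} ?f + integral {0..real N} ?f"
      by (rule Henstock_Kurzweil_Integration.integral_combine[symmetric])
        (auto intro!: integrable_continuous_real cont)
    also have "integral {- real N..0} ?f = integral {0..real N} ?f"
      using Henstock_Kurzweil_Integration.integral_reflect_real[of "real N" 0 ?f] by simp
    finally show ?thesis by simp
  qed
  ultimately have "((\<lambda>N. 2 * integral {0..real N} ?f) \<longlongrightarrow> exp (- (pi * c\<^sup>2 / x)) / sqrt x) sequentially"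
    using hb by (simp add: has_bochner_integral_iff)
  then have "((\<lambda>N. 1/2 * (2 * integral {0..real N} ?f)) \<longlongrightarrow> 1/2 * (exp (- (pi * c\<^sup>2 / x)) / sqrt x)) sequentially"
    by (intro tendsto_intros)
  then show ?thesis by simp
qed

section \<open>The theta series\<close>

text \<open>For x > 0, \<open>1 + 2 * omega x\<close> is Jacobi's theta function, the sum of exp (-
  pi n^2 x) over all integers n.\<close>

definition omega :: "real \<Rightarrow> real" where
  "omega x = (\<Sum>n. exp (- (pi * real (Suc n) ^ 2 * x)))"

lemma exp_square_le_power:
  assumes "x > 0" "real n \<le> a\<^sup>2"
  shows "exp (- (pi * x * a\<^sup>2)) \<le> exp (- (pi * x)) ^ n"
proof -
  have "pi * x * real n \<le> pi * x * a\<^sup>2" using assms by (intro mult_left_mono) auto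
  then have "exp (- (pi * x * a\<^sup>2)) \<le> exp (real n * (- (pi * x)))" by (simp add: mult_ac)
  then show ?thesis by (simp only: exp_of_nat_mult)
qed

lemma real_le_square_if_le:
  assumes "real n \<le> a"
  shows "real n \<le> a\<^sup>2"
proof -
  have "real n \<le> real (n ^ 2)" by (simp add: power2_eq_square del: of_nat_mult)
  also have "\<dots> \<le> a\<^sup>2" using assms by (auto intro!: power_mono)
  finally show ?thesis .
qed

lemma summable_exp_power: "x > 0 \<Longrightarrow> summable (\<lambda>n. exp (- (pi * x)) ^ n)"
  by (rule summable_geometric) simp

lemma summable_omega: 
  assumes "x > 0"
  shows "summable (\<lambda>n. exp (- (pi * real (Suc n) ^ 2 * x)))"
proof (rule summable_comparison_test'[where N=0])
  show "summable (\<lambda>n. exp (- (pi * x)) ^ Suc n)"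
    using summable_exp_power[OF assms] summable_Suc_iff by blast
  show "norm (exp (- (pi * real (Suc n) ^ 2 * x))) \<le> exp (- (pi * x)) ^ Suc n" for n
    using exp_square_le_power[OF assms real_le_square_if_le[of "Suc n" "real (Suc n)"]] by (simp only: norm_exp mult_ac) (simp add: mult_ac)
qed

text \<open>The function \<open>g\<close> below arises by folding the half-line onto \<open>[0, 1/2]\<close>. The cosines
  \<open>cos (2 * pi * m * v)\<close> are invariant under the folding maps, so the cosine coefficients of \<open>g\<close> are
  half-line Gaussian integrals, and \<open>G\<close> is the cosine series with the same coefficients.\<close>

lemma theta_functional_equation:
  assumes x: "x > 0"
  shows "1 + 2 * omega x = (1 + 2 * omega (1 / x)) / sqrt x"
proof -
  define e where "e = (\<lambda>v. exp (- (pi * x * v\<^sup>2)))"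
  \<comment> \<open>For \<open>u\<close> in \<open>[0, 1/2]\<close> the argument n + u runs through
    the left half of [n, n + 1] and n + 1 - u through the right half, so the sum over
    \<open>n\<close> covers the half-line.\<close>
  define f where "f = (\<lambda>n u. e (real n + u) + e (real (Suc n) - u))"
  define c where "c = (\<lambda>k. exp (- (pi * real (Suc k) ^ 2 * (1 / x))))"
  define g where "g = (\<lambda>u. \<Sum>n. f n u)"
  define S where "S = (\<lambda>u. \<Sum>k. c k * cos (2 * pi * real (Suc k) * u))"
  define G where "G = (\<lambda>u. (1 + 2 * S u) / sqrt x)"
  have cont_e: "continuous_on A (\<lambda>u. e (h u))" if "continuous_on A h" for A and h :: "real \<Rightarrow> real"
    unfolding e_def by (intro continuous_intros that)
  have cont_f: "continuous_on A (f n)" for A n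
    unfolding f_def by (intro continuous_intros cont_e)
  have f_bound: "\<bar>f n u\<bar> \<le> 2 * exp (- (pi * x)) ^ n" if "u \<in> {0..1/2}" for n u
  proof -
    have "e (real n + u) \<le> exp (- (pi * x)) ^ n" "e (real (Suc n) - u) \<le> exp (- (pi * x)) ^ n"
      unfolding e_def using that by (auto intro!: exp_square_le_power x real_le_square_if_le)
    moreover have "e (real n + u) \<ge> 0" "e (real (Suc n) - u) \<ge> 0" by (simp_all add: e_def)
    ultimately show ?thesis by (simp add: f_def)
  qed
  have f_cos_bound: "\<bar>f n u * cos t\<bar> \<le> 2 * exp (- (pi * x)) ^ n" if "u \<in> {0..1/2}" for n u t
    using mult_mono[OF f_bound[OF that, of n] abs_cos_le_one[of t]] by (simp add: abs_mult)
  have summ_f: "summable (\<lambda>n. 2 * exp (- (pi * x)) ^ n)"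
    by (intro summable_mult summable_exp_power x)
  have summ_f': "summable (\<lambda>n. f n u)" if "u \<in> {0..1/2}" for u
    by (rule summable_comparison_test'[OF summ_f, of 0]) (use f_bound[OF that] in auto)
  have cont_g: "continuous_on {0..1/2} g"
    unfolding g_def by (rule sums_integral_M_test(1)[OF cont_f f_bound summ_f])
  have summ_c: "summable c"
    unfolding c_def using x by (intro summable_omega) auto
  have c_nonneg: "c k \<ge> 0" for k by (simp add: c_def)
  have c_bound: "\<bar>c k * cos t\<bar> \<le> c k" for k t
    using mult_left_mono[OF abs_cos_le_one[of t] c_nonneg[of k]] c_nonneg[of k] by (simp add: abs_mult)
  have summ_ccos: "summable (\<lambda>k. c k * cos (t k))" for t
    by (rule summable_comparison_test'[OF summ_c, of 0]) (use c_bound in auto)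
  have cont_S: "continuous_on {0..1/2} S"
    unfolding S_def by (rule sums_integral_M_test(1)[OF _ c_bound summ_c]) (intro continuous_intros)
  have cont_G: "continuous_on {0..1/2} G"
    unfolding G_def using x by (intro continuous_intros cont_S) auto
  have coeff_g: "integral {0..1/2} (\<lambda>u. g u * cos (2 * pi * real m * u)) = exp (- (pi * (real m)\<^sup>2 / x)) / (2 * sqrt x)" for m
  proof -
    define \<phi> where "\<phi> = (\<lambda>v. e v * cos (2 * pi * real m * v))"
    have cont_\<phi>: "continuous_on A (\<lambda>u. \<phi> (h u))" if "continuous_on A h" for A and h :: "real \<Rightarrow> real"
      unfolding \<phi>_def by (intro continuous_intros cont_e that)
    have "(\<lambda>n. integral {0..1/2} (\<lambda>u. f n u * cos (2 * pi * real m * u))) sums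
        integral {0..1/2} (\<lambda>u. \<Sum>n. f n u * cos (2 * pi * real m * u))"
      by (rule sums_integral_M_test(2)[OF _ f_cos_bound summ_f]) (intro continuous_intros cont_f)
    also have "integral {0..1/2} (\<lambda>u. \<Sum>n. f n u * cos (2 * pi * real m * u)) = integral {0..1/2} (\<lambda>u. g u * cos (2 * pi * real m * u))"
      unfolding g_def by (intro Henstock_Kurzweil_Integration.integral_cong suminf_mult2[symmetric] summ_f')
    finally have sums: "(\<lambda>n. integral {0..1/2} (\<lambda>u. f n u * cos (2 * pi * real m * u))) sums
       integral {0..1/2} (\<lambda>u. g u * cos (2 * pi * real m * u))" .
    have piece: "integral {0..1/2} (\<lambda>u. f n u * cos (2 * pi * real m * u)) = integral {real n..real (Suc n)} \<phi>" for n
    proof -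
      have c1: "cos (2 * pi * real m * (u + real n)) = cos (2 * pi * real m * u)" for u
      proof -
        have "2 * pi * real m * (u + real n) = 2 * pi * real m * u + 2 * real (m * n) * pi" by (simp add: algebra_simps)
        then show ?thesis by (simp only: cos_add cos_2npi sin_2npi)
      qed
      have c2: "cos (2 * pi * real m * (- u + real (Suc n))) = cos (2 * pi * real m * u)" for u
      proof -
        have "2 * pi * real m * (- u + real (Suc n)) = 2 * real (m * Suc n) * pi - 2 * pi * real m * u" by (simp add: algebra_simps)
        then show ?thesis by (simp only: cos_diff cos_2npi sin_2npi)
      qed
      have "f n u * cos (2 * pi * real m * u) = \<phi> (u + real n) + \<phi> (- u + real (Suc n))" for u
        unfolding f_def \<phi>_def c1 c2 by (simp add: algebra_simps)
      then have "integral {0..1/2} (\<lambda>u. f n u * cos (2 * pi * real m * u)) =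
          integral {0..1/2} (\<lambda>u. \<phi> (u + real n)) + integral {0..1/2} (\<lambda>u. \<phi> (- u + real (Suc n)))"
        by (simp only:) (intro Henstock_Kurzweil_Integration.integral_add integrable_continuous_real continuous_intros cont_\<phi>)
      also have "integral {0..1/2} (\<lambda>u. \<phi> (u + real n)) = integral {real n..real n + 1/2} \<phi>"
        using integral_shift[of 0 "real n" "1/2" \<phi>] cont_\<phi>[OF continuous_on_id] by (simp add: o_def add_ac)
      also have "integral {0..1/2} (\<lambda>u. \<phi> (- u + real (Suc n))) = integral {-(1/2)..0} (\<lambda>u. \<phi> (u + real (Suc n)))"
        using Henstock_Kurzweil_Integration.integral_reflect_real[of 0 "-1/2" "\<lambda>u. \<phi> (u + real (Suc n))"] by simp
      also have "\<dots> = integral {real n + 1/2..real (Suc n)} \<phi>"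
        using integral_shift[of "-1/2" "real (Suc n)" 0 \<phi>] cont_\<phi>[OF continuous_on_id] by (simp add: o_def add_ac)
      also have "integral {real n..real n + 1/2} \<phi> + integral {real n + 1/2..real (Suc n)} \<phi> = integral {real n..real (Suc n)} \<phi>"
        by (rule Henstock_Kurzweil_Integration.integral_combine) (auto intro!: integrable_continuous_real cont_\<phi> continuous_intros)
      finally show ?thesis .
    qed
    have "(\<Sum>n<N. integral {0..1/2} (\<lambda>u. f n u * cos (2 * pi * real m * u))) = integral {0..real N} \<phi>" for N
    proof (induction N)
      case (Suc N)
      have "integral {0..real N} \<phi> + integral {real N..real (Suc N)} \<phi> = integral {0..real (Suc N)} \<phi>"
        by (rule Henstock_Kurzweil_Integration.integral_combine) (auto intro!: integrable_continuous_real cont_\<phi> continuous_intros)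
      with Suc piece show ?case by simp
    qed simp
    then have "(\<lambda>N. integral {0..real N} \<phi>) \<longlonglongrightarrow> integral {0..1/2} (\<lambda>u. g u * cos (2 * pi * real m * u))"
      using sums by (simp add: sums_def)
    moreover have "(\<lambda>N. integral {0..real N} \<phi>) \<longlonglongrightarrow> exp (- (pi * (real m)\<^sup>2 / x)) / (2 * sqrt x)"
      using gaussian_cos_half_line[OF x, of "real m"] by (simp add: \<phi>_def e_def)
    ultimately show ?thesis by (rule LIMSEQ_unique)
  qed
  have coeff_G: "integral {0..1/2} (\<lambda>u. G u * cos (2 * pi * real m * u)) = exp (- (pi * (real m)\<^sup>2 / x)) / (2 * sqrt x)" for m
  proof -
    let ?t = "\<lambda>k u. c k * cos (2 * pi * real (Suc k) * u) * cos (2 * pi * real m * u)"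
    have t_bound: "\<bar>?t k u\<bar> \<le> c k" for k u
      using mult_mono[OF c_bound[of k "2 * pi * real (Suc k) * u"] abs_cos_le_one[of "2 * pi * real m * u"]] c_nonneg[of k]
      by (simp add: abs_mult)
    have "(\<lambda>k. integral {0..1/2} (?t k)) sums integral {0..1/2} (\<lambda>u. \<Sum>k. ?t k u)"
      by (rule sums_integral_M_test(2)[OF _ t_bound summ_c]) (intro continuous_intros)
    also have "integral {0..1/2} (\<lambda>u. \<Sum>k. ?t k u) = integral {0..1/2} (\<lambda>u. S u * cos (2 * pi * real m * u))"
      unfolding S_def by (intro Henstock_Kurzweil_Integration.integral_cong suminf_mult2[symmetric] summ_ccos)
    \<comment> \<open>Orthogonality leaves at most one term. \<open>S\<close> starts at frequency 1,
      so \<open>m\<close> selects the index m - 1; for m = 0 nothing is left, and the coefficient of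
      \<open>G\<close> then comes from its constant summand alone.\<close>
    also have "(\<lambda>k. integral {0..1/2} (?t k)) = (\<lambda>k. if Suc k = m then c k / 4 else 0)"
    proof
      fix k
      show "integral {0..1/2} (?t k) = (if Suc k = m then c k / 4 else 0)"
        using integral_Icc_cos_cos[of "Suc k" m]
        by (simp only: mult.assoc integral_mult_right) (auto simp: field_simps)
    qed
    finally have 1: "(\<lambda>k. if Suc k = m then c k / 4 else 0) sums integral {0..1/2} (\<lambda>u. S u * cos (2 * pi * real m * u))" .
    have 2: "(\<lambda>k. if Suc k = m then c k / 4 else 0) sums (if m = 0 then 0 else c (m - 1) / 4)"
    proof (cases m)
      case (Suc j)
      then show ?thesis using sums_single[of j "\<lambda>k. c k / 4"] by (simp add: eq_commute)
    qed auto
    have S: "integral {0..1/2} (\<lambda>u. S u * cos (2 * pi * real m * u)) = (if m = 0 then 0 else c (m - 1) / 4)"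
      using sums_unique2[OF 1 2] .
    have "integral {0..1/2} (\<lambda>u. G u * cos (2 * pi * real m * u)) =
        integral {0..1/2} (\<lambda>u. (cos (2 * pi * real 0 * u) * cos (2 * pi * real m * u) + 2 * (S u * cos (2 * pi * real m * u))) / sqrt x)"
      by (intro Henstock_Kurzweil_Integration.integral_cong) (simp add: G_def field_simps)
    also have "\<dots> = (integral {0..1/2} (\<lambda>u. cos (2 * pi * real 0 * u) * cos (2 * pi * real m * u)) + 2 * integral {0..1/2} (\<lambda>u. S u * cos (2 * pi * real m * u))) / sqrt x"
      unfolding integral_divide
      by (subst Henstock_Kurzweil_Integration.integral_add) (auto intro!: integrable_continuous_real continuous_intros cont_S)
    also have "\<dots> = exp (- (pi * (real m)\<^sup>2 / x)) / (2 * sqrt x)"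
      unfolding S integral_Icc_cos_cos by (simp add: c_def)
    finally show ?thesis .
  qed
  have "g 0 - G 0 = 0"
  proof (rule cosine_coefficients_zero_imp_zero[of "\<lambda>u. g u - G u"])
    show "continuous_on {0..1/2} (\<lambda>u. g u - G u)" by (intro continuous_intros cont_g cont_G)
    show "integral {0..1/2} (\<lambda>u. (g u - G u) * cos (2 * pi * real k * u)) = 0" for k
      unfolding left_diff_distrib
      by (subst Henstock_Kurzweil_Integration.integral_diff)
        (auto intro!: integrable_continuous_real continuous_intros cont_g cont_G simp: coeff_g coeff_G)
  qed auto
  moreover have "G 0 = (1 + 2 * omega (1 / x)) / sqrt x"
    by (simp add: G_def S_def c_def omega_def)
  \<comment> \<open>At u = 0 the points n + u and n + 1 - u hit 0 once and every positive integer
    twice.\<close>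
  moreover have "g 0 = 1 + 2 * omega x"
  proof -
    have e_Suc: "(\<lambda>n. e (real (Suc n))) sums omega x"
      using summable_sums[OF summable_omega[OF x]] by (simp add: e_def omega_def mult_ac)
    have "(\<lambda>n. e (real n)) sums (omega x + e (real 0))"
      using e_Suc by (subst (asm) sums_Suc_iff) (simp add: add.commute)
    from sums_add[OF this e_Suc] have "(\<lambda>n. f n 0) sums (omega x + e (real 0) + omega x)"
      by (simp add: f_def)
    then show ?thesis by (simp add: g_def sums_iff e_def)
  qed
  ultimately show ?thesis by simp
qed

section \<open>The cosine transform of \<open>1 / (t\<^sup>2 + a\<^sup>2)\<close>\<close>

text \<open>Antiderivatives and Cauchy's theorem evaluate integrals over \<open>[0, N]\<close>.
  Absolute integrability, as dominated convergence, passes from these to the Lebesgue integral over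
  the half-line.\<close>

lemma tendsto_integral_half_line:
  fixes f :: "real \<Rightarrow> complex"
  assumes f: "set_integrable lborel {0..} f"
  shows "(\<lambda>N. integral {0..real N} f) \<longlonglongrightarrow> (LBINT t:{0..}. f t)"
proof -
  have "((\<lambda>N. LBINT t. indicator {0..real N} t *\<^sub>R f t) \<longlongrightarrow> (LBINT t. indicator {0..} t *\<^sub>R f t)) sequentially"
  proof (rule integral_dominated_convergence)
    have "set_borel_measurable lborel {0..} f"
      using f unfolding set_integrable_def set_borel_measurable_def by (rule borel_measurable_integrable)
    then have *: "set_borel_measurable lborel {0..real N} f" for N
      by (rule set_borel_measurable_subset) auto
    then show "(\<lambda>t. indicator {0..real N} t *\<^sub>R f t) \<in> borel_measurable lborel" for N
      by (simp add: set_borel_measurable_def)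
    show "integrable lborel (\<lambda>t. norm (indicator {0..} t *\<^sub>R f t))"
      using f unfolding set_integrable_def by (rule integrable_norm)
    show "(\<lambda>t. indicator {0..} t *\<^sub>R f t) \<in> borel_measurable lborel"
      using f unfolding set_integrable_def by (rule borel_measurable_integrable)
    show "AE t in lborel. (\<lambda>N. indicator {0..real N} t *\<^sub>R f t) \<longlonglongrightarrow> indicator {0..} t *\<^sub>R f t"
    proof (rule AE_I2)
      fix t :: real
      obtain m where m: "\<bar>t\<bar> \<le> real m" using real_arch_simple by blast
      have "eventually (\<lambda>N. indicator {0..real N} t *\<^sub>R f t = indicator {0..} t *\<^sub>R f t) sequentially"
        using eventually_ge_at_top[of m] by eventually_elim (use m in \<open>auto simp: indicator_def\<close>)
      then show "(\<lambda>N. indicator {0..real N} t *\<^sub>R f t) \<longlonglongrightarrow> indicator {0..} t *\<^sub>R f t"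
        by (rule tendsto_eventually)
    qed
  qed (auto simp: indicator_def)
  moreover have "(LBINT t. indicator {0..real N} t *\<^sub>R f t) = integral {0..real N} f" for N
  proof -
    have "set_integrable lborel {0..real N} f"
      by (rule set_integrable_subset[OF f]) auto
    then show ?thesis
      using set_borel_integral_eq_integral(2) by (simp only: set_lebesgue_integral_def)
  qed
  ultimately show ?thesis by (simp add: set_lebesgue_integral_def)
qed

text \<open>The constant comes from
  \<open>t\<^sup>2 \<le> 2 * (t - b)\<^sup>2 + 2 * b\<^sup>2\<close>; the remaining
  \<open>1 + 2 * b\<^sup>2\<close> is absorbed by the summand \<open>r\<^sup>2\<close>, which
  explains the quotient.\<close>

lemma one_plus_square_le:
  fixes b r t :: real
  assumes "r > 0"
  shows "1 + t\<^sup>2 \<le> (2 + (1 + 2 * b\<^sup>2) / r\<^sup>2) * ((t - b)\<^sup>2 + r\<^sup>2)"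
proof -
  have "0 \<le> (t - 2 * b)\<^sup>2 + 2 * r\<^sup>2 + (1 + 2 * b\<^sup>2) / r\<^sup>2 * (t - b)\<^sup>2" by (intro add_nonneg_nonneg) auto
  then show ?thesis using assms by (simp add: field_simps power2_eq_square)
qed

text \<open>In t^2 + a^2 = (t - i a) (t + i a) the factors have squared moduli (t + Im a)^2 + (Re
  a)^2 and (t - Im a)^2 + (Re a)^2. The preceding estimate holds for each, and their product bounds
  the square of 1 + t^2.\<close>

lemma norm_quadratic_ge:
  assumes "Re a > 0"
  obtains c where "c > 0" "\<And>t. c * (1 + t\<^sup>2) \<le> norm (of_real t ^ 2 + a ^ 2)"
proof -
  define K where "K = 2 + (1 + 2 * (Im a)\<^sup>2) / (Re a)\<^sup>2"
  have K: "K > 0" unfolding K_def by (intro add_pos_nonneg) auto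
  have "1 + t\<^sup>2 \<le> K * norm (of_real t ^ 2 + a ^ 2)" for t
  proof -
    have 1: "1 + t\<^sup>2 \<le> K * (norm (of_real t - \<i> * a))\<^sup>2"
      using one_plus_square_le[OF assms, of t "- Im a"] by (simp add: cmod_power2 K_def)
    have 2: "1 + t\<^sup>2 \<le> K * (norm (of_real t + \<i> * a))\<^sup>2"
      using one_plus_square_le[OF assms, of t "Im a"] by (simp add: cmod_power2 K_def)
    have "of_real t ^ 2 + a ^ 2 = (of_real t - \<i> * a) * (of_real t + \<i> * a)"
      by (simp add: algebra_simps power2_eq_square)
    moreover have "(1 + t\<^sup>2)\<^sup>2 \<le> (K * norm ((of_real t - \<i> * a) * (of_real t + \<i> * a)))\<^sup>2"
    proof -
      have "(1 + t\<^sup>2) * (1 + t\<^sup>2) \<le> (K * (norm (of_real t - \<i> * a))\<^sup>2) * (K * (norm (of_real t + \<i> * a))\<^sup>2)"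
        using K by (intro mult_mono 1 2) auto
      then show ?thesis by (simp add: norm_mult power_mult_distrib power2_eq_square mult_ac)
    qed
    ultimately show ?thesis using K by (simp only:) (rule power2_le_imp_le, auto)
  qed
  then show ?thesis using K by (intro that[of "1 / K"]) (auto simp: field_simps)
qed

lemma quadratic_nonzero:
  assumes "Re a > 0"
  shows "of_real t ^ 2 + a ^ 2 \<noteq> 0"
proof -
  obtain c where c: "c > 0" "c * (1 + t\<^sup>2) \<le> norm (of_real t ^ 2 + a ^ 2)"
    using norm_quadratic_ge[OF assms] by metis
  moreover have "c * (1 + t\<^sup>2) > 0" using c by (intro mult_pos_pos add_pos_nonneg) auto
  ultimately show ?thesis by auto
qed

lemma integrable_div_quadratic:
  fixes f :: "real \<Rightarrow> complex"
  assumes a: "Re a > 0" and [measurable]: "f \<in> borel_measurable borel" and f: "\<And>t. norm (f t) \<le> B"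
  shows "set_integrable lborel {0..} (\<lambda>t. f t / (of_real t ^ 2 + a ^ 2))"
proof -
  obtain c where c: "c > 0" "\<And>t. c * (1 + t\<^sup>2) \<le> norm (of_real t ^ 2 + a ^ 2)"
    using norm_quadratic_ge[OF a] by metis
  have B: "B \<ge> 0" using f[of 0] norm_ge_zero order_trans by blast
  have "set_integrable lborel {0<..} (\<lambda>t. 1 / (1 + t\<^sup>2) :: real)"
    using integrable_I0i_1_div_plus_square by (simp add: interval_lebesgue_integral_0_infty)
  then have "set_integrable lborel {0..} (\<lambda>t. 1 / (1 + t\<^sup>2) :: real)"
    unfolding set_integrable_def
    by (rule integrable_cong_AE_imp)
      (use AE_lborel_singleton[of 0] in \<open>auto elim!: eventually_mono simp: indicator_def\<close>)
  then have "integrable lborel (\<lambda>t. B / c * (indicator {0..} t *\<^sub>R (1 / (1 + t\<^sup>2)) :: real))"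
    unfolding set_integrable_def by (rule integrable_mult_right)
  then show ?thesis unfolding set_integrable_def
  proof (rule Bochner_Integration.integrable_bound)
    show "AE t in lborel. norm (indicator {0..} t *\<^sub>R (f t / (of_real t ^ 2 + a ^ 2))) \<le>
       norm (B / c * (indicator {0..} t *\<^sub>R (1 / (1 + t\<^sup>2)) :: real))"
    proof (rule AE_I2)
      fix t :: real
      have p: "c * (1 + t\<^sup>2) > 0" using c by (intro mult_pos_pos add_pos_nonneg) auto
      have "norm (f t / (of_real t ^ 2 + a ^ 2)) \<le> B / (c * (1 + t\<^sup>2))"
        unfolding norm_divide using p c f B by (intro frac_le) auto
      then show "norm (indicator {0..} t *\<^sub>R (f t / (of_real t ^ 2 + a ^ 2))) \<le>
         norm (B / c * (indicator {0..} t *\<^sub>R (1 / (1 + t\<^sup>2)) :: real))"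
        using B c(1) by (auto simp: indicator_def abs_mult)
    qed
  qed simp
qed

text \<open>Partial fractions give the difference \<open>L\<close> of two principal logarithms as
  antiderivative. It is differentiable along the whole real line: the imaginary parts of t - i a and
  t + i a are - Re a and Re a, so the branch cut is never met.\<close>

lemma integral_inverse_quadratic:
  assumes a: "Re a > 0"
  shows "(LBINT t:{0..}. 1 / (of_real t ^ 2 + a ^ 2)) = of_real pi / (2 * a)"
proof -
  have a0: "a \<noteq> 0" using a by auto
  define L where "L = (\<lambda>t::real. (Ln (of_real t - \<i> * a) - Ln (of_real t + \<i> * a)) / (2 * \<i> * a))"
  have nn: "of_real t - \<i> * a \<notin> \<real>\<^sub>\<le>\<^sub>0" "of_real t + \<i> * a \<notin> \<real>\<^sub>\<le>\<^sub>0" for t :: real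
    using a by (auto simp: complex_nonpos_Reals_iff)
  have nz: "of_real t - \<i> * a \<noteq> 0" "of_real t + \<i> * a \<noteq> 0" for t :: real
    using nn[of t] by auto
  have der: "(L has_vector_derivative 1 / (of_real t ^ 2 + a ^ 2)) (at t within A)" for t A
  proof -
    have *: "(1 / A - 1 / B) / (B - A) = 1 / (A * B)" if "A \<noteq> 0" "B \<noteq> 0" "B - A \<noteq> 0" for A B :: complex
      using that by (simp add: field_simps)
    have "((\<lambda>z. Ln (z - \<i> * a) - Ln (z + \<i> * a)) has_field_derivative
       (1 / (of_real t - \<i> * a) - 1 / (of_real t + \<i> * a))) (at (of_real t))"
      using nn[of t] by (auto intro!: derivative_eq_intros simp: inverse_eq_divide)
    then have "((\<lambda>z. (Ln (z - \<i> * a) - Ln (z + \<i> * a)) / (2 * \<i> * a)) has_field_derivative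
       (1 / (of_real t - \<i> * a) - 1 / (of_real t + \<i> * a)) / (2 * \<i> * a)) (at (of_real t))"
      by (rule DERIV_cdivide)
    also have "(1 / (of_real t - \<i> * a) - 1 / (of_real t + \<i> * a)) / (2 * \<i> * a) = 1 / (of_real t ^ 2 + a ^ 2)"
      using *[OF nz[of t]] a0 by (simp add: algebra_simps power2_eq_square)
    finally show ?thesis
      unfolding L_def by (rule has_vector_derivative_real_field)
  qed
  have int: "integral {0..real N} (\<lambda>t. 1 / (of_real t ^ 2 + a ^ 2)) = L (real N) - L 0" for N
    by (rule integral_unique, rule fundamental_theorem_of_calculus) (use der in auto)
  have L0: "L 0 = - of_real pi / (2 * a)"
  proof -
    \<comment> \<open>\<open>\<i> * a\<close> lies in the upper half-plane, so its negative has the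
      principal logarithm smaller by i pi. The whole value of the integral arises here.\<close>
    have "Ln (0 - \<i> * a) - Ln (0 + \<i> * a) = - \<i> * of_real pi"
      using a a0 by (simp add: Ln_minus)
    then have "L 0 = - \<i> * of_real pi / (2 * \<i> * a)" by (simp only: L_def of_real_0)
    then show ?thesis using a0 by simp
  qed
  have "(\<lambda>N. L (real N)) \<longlonglongrightarrow> 0"
  proof -
    have lim: "(\<lambda>N. w / of_real (real N)) \<longlonglongrightarrow> 0" for w :: complex
      by (intro tendsto_divide_0[OF tendsto_const]) (simp add: tendsto_of_nat)
    \<comment> \<open>The positive factor N is taken out of both logarithms, and its real logarithm
      cancels in the difference.\<close>
    have "(\<lambda>N. (Ln (1 - \<i> * a / of_real (real N)) - Ln (1 + \<i> * a / of_real (real N))) / (2 * \<i> * a)) \<longlonglongrightarrow> (Ln (1 - 0) - Ln (1 + 0)) / (2 * \<i> * a)"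
      using a0 by (intro tendsto_intros lim) auto
    moreover have "eventually (\<lambda>N. (Ln (1 - \<i> * a / of_real (real N)) - Ln (1 + \<i> * a / of_real (real N))) / (2 * \<i> * a) = L (real N)) sequentially"
      using eventually_gt_at_top[of 0]
    proof eventually_elim
      case (elim N)
      have e1: "of_real (real N) - \<i> * a = of_real (real N) * (1 - \<i> * a / of_real (real N))"
        and e2: "of_real (real N) + \<i> * a = of_real (real N) * (1 + \<i> * a / of_real (real N))"
        using elim by (simp_all add: field_simps)
      then have z: "1 - \<i> * a / of_real (real N) \<noteq> 0" "1 + \<i> * a / of_real (real N) \<noteq> 0"
        using nz[of "real N"] by auto
      show ?case unfolding L_def e1 e2
        using z elim by (simp add: Ln_times_of_real del: of_real_of_nat_eq)
    qed
    ultimately show ?thesis by (simp add: tendsto_cong)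
  qed
  then have "(\<lambda>N. integral {0..real N} (\<lambda>t. 1 / (of_real t ^ 2 + a ^ 2))) \<longlonglongrightarrow> 0 - L 0"
    unfolding int by (intro tendsto_intros)
  moreover have "(\<lambda>N. integral {0..real N} (\<lambda>t. 1 / (of_real t ^ 2 + a ^ 2))) \<longlonglongrightarrow> (LBINT t:{0..}. 1 / (of_real t ^ 2 + a ^ 2))"
    using integrable_div_quadratic[OF a, of "\<lambda>_. 1" 1] by (intro tendsto_integral_half_line) auto
  ultimately show ?thesis using LIMSEQ_unique L0 by fastforce
qed

lemma norm_exp_i_times_le: "Im z \<ge> 0 \<Longrightarrow> y \<ge> 0 \<Longrightarrow> norm (exp (\<i> * z * of_real y)) \<le> 1"
  by simp

text \<open>The value of the numerator at the pole \<open>\<i> * a\<close> is subtracted, so that Cauchy's theorem on half discs applies directly.\<close>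

lemma integral_cos_div_quadratic:
  assumes a: "Re a > 0" and y: "y \<ge> 0"
  shows "(LBINT t:{0..}. of_real (cos (t * y)) / (of_real t ^ 2 + a ^ 2)) = of_real pi / (2 * a) * exp (- a * of_real y)"
proof -
  \<comment> \<open>\<open>U\<close> contains the closed upper half-plane and with it the pole
    \<open>\<i> * a\<close>, where the singularity is removed, but it avoids the other pole
    \<open>- \<i> * a\<close>.\<close>
  define U where "U = {z. Im z > - Re a}"
  define E where "E = (\<lambda>z. exp (\<i> * z * of_real y))"
  define D where "D = (\<lambda>z. if z = \<i> * a then deriv E (\<i> * a) else (E z - E (\<i> * a)) / (z - \<i> * a))"
  define g where "g = (\<lambda>z. D z / (z + \<i> * a))"
  have Ea: "E (\<i> * a) = exp (- a * of_real y)" by (simp add: E_def flip: mult.assoc)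
  have "open U" "convex U" unfolding U_def
    by (auto simp: open_halfspace_Im_gt convex_halfspace_Im_gt)
  have "E holomorphic_on U" unfolding E_def by (intro holomorphic_intros)
  then have "D holomorphic_on U"
    unfolding D_def using \<open>open U\<close> by (rule pole_lemma_open)
  moreover have "z + \<i> * a \<noteq> 0" if "z \<in> U" for z
    using that by (auto simp: U_def complex_eq_iff)
  ultimately have hol: "g holomorphic_on U"
    unfolding g_def by (intro holomorphic_intros) auto
  have g_eq: "g z = (E z - E (\<i> * a)) / (z ^ 2 + a ^ 2)" if "z \<noteq> \<i> * a" for z
    using that by (simp add: g_def D_def algebra_simps power2_eq_square)
  define h where "h = (\<lambda>t::real. (of_real (cos (t * y)) - exp (- a * of_real y)) / (of_real t ^ 2 + a ^ 2))"
  \<comment> \<open>The arc has length pi R, and on it the integrand is at most 2 / (R^2 - |a|^2).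
    Folding the diameter at 0 gives \<open>2 * h\<close>, which cancels the 2.\<close>
  have bound: "norm (integral {0..R} h) \<le> pi * R / (R\<^sup>2 - (norm a)\<^sup>2)" if R: "R > norm a" for R
  proof -
    have R0: "R > 0" using R norm_ge_zero[of a] by linarith
    define p where "p = linepath (of_real (- R)) (of_real R) +++ part_circlepath 0 R 0 pi"
    have arc_image: "norm z = R \<and> Im z \<ge> 0" if z: "z \<in> path_image (part_circlepath 0 R 0 pi)" for z
    proof -
      obtain \<theta> where \<theta>: "0 \<le> \<theta>" "\<theta> \<le> pi" "z = of_real R * exp (\<i> * of_real \<theta>)"
        using z by (auto simp: path_image_part_circlepath)
      have "Im z = R * sin \<theta>" unfolding \<theta>(3) by (simp add: Im_exp)
      then show ?thesis using \<theta> R0 sin_ge_zero by (auto simp: norm_mult)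
    qed
    have vp: "valid_path p" unfolding p_def by (intro valid_path_join) auto
    have img: "path_image p \<subseteq> U"
    proof -
      have "closed_segment (of_real (- R)) (of_real R) \<subseteq> U"
        using a by (intro closed_segment_subset \<open>convex U\<close>) (auto simp: U_def)
      moreover have "path_image (part_circlepath 0 R 0 pi) \<subseteq> U"
        using a arc_image by (fastforce simp: U_def)
      ultimately show ?thesis unfolding p_def by (intro order_trans[OF path_image_join_subset]) auto
    qed
    have "(g has_contour_integral 0) p"
      by (rule Cauchy_theorem_convex_simple[OF hol \<open>convex U\<close> vp img]) (auto simp: p_def)
    then have int: "g contour_integrable_on p" "contour_integral p g = 0"
      by (auto simp: contour_integrable_on_def contour_integral_unique)
    then have int1: "g contour_integrable_on linepath (of_real (- R)) (of_real R)" 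
      and int2: "g contour_integrable_on part_circlepath 0 R 0 pi"
      unfolding p_def by (auto simp: contour_integrable_join)
    have sum: "contour_integral (linepath (of_real (- R)) (of_real R)) g + contour_integral (part_circlepath 0 R 0 pi) g = 0"
      using int int1 int2 unfolding p_def by (simp add: contour_integral_join)
    have arc: "norm (contour_integral (part_circlepath 0 R 0 pi) g) \<le> 2 / (R\<^sup>2 - (norm a)\<^sup>2) * R * \<bar>pi - 0\<bar>"
    proof (rule contour_integral_bound_part_circlepath[OF int2])
      have sq: "R\<^sup>2 - (norm a)\<^sup>2 > 0" using R by (simp add: power_strict_mono)
      then show "0 \<le> 2 / (R\<^sup>2 - (norm a)\<^sup>2)" by simp
      fix z assume "z \<in> path_image (part_circlepath 0 R 0 pi)"
      then have nz: "norm z = R" and iz: "Im z \<ge> 0"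
        using arc_image by auto
      have "z \<noteq> \<i> * a" using nz R by (auto simp: norm_mult)
      then have "norm (g z) = norm (E z - E (\<i> * a)) / norm (z ^ 2 + a ^ 2)"
        using g_eq by (simp add: norm_divide)
      also have "\<dots> \<le> 2 / (R\<^sup>2 - (norm a)\<^sup>2)"
      proof (rule frac_le)
        have "norm (E z - E (\<i> * a)) \<le> norm (E z) + norm (E (\<i> * a))" by (rule norm_triangle_ineq4)
        also have "\<dots> \<le> 1 + 1" unfolding E_def
          by (intro add_mono norm_exp_i_times_le iz y) (use a in auto)
        finally show "norm (E z - E (\<i> * a)) \<le> 2" by simp
        show "R\<^sup>2 - (norm a)\<^sup>2 \<le> norm (z ^ 2 + a ^ 2)"
          using norm_diff_ineq[of "z ^ 2" "a ^ 2"] nz by (simp add: norm_power)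
      qed (use sq in auto)
      finally show "norm (g z) \<le> 2 / (R\<^sup>2 - (norm a)\<^sup>2)" .
    qed (use R0 in auto)
    have "(g has_contour_integral contour_integral (linepath (of_real (- R)) (of_real R)) g) (linepath (of_real (- R)) (of_real R))"
      using int1 by (rule has_contour_integral_integral)
    then have "((\<lambda>t. g (of_real t)) has_integral contour_integral (linepath (of_real (- R)) (of_real R)) g) {-R..R}"
      using R0 by (subst (asm) has_contour_integral_linepath_Reals_iff) auto
    then have "contour_integral (linepath (of_real (- R)) (of_real R)) g = integral {-R..R} (\<lambda>t. g (of_real t))"
      and int3: "(\<lambda>t. g (of_real t)) integrable_on {-R..R}"
      by (auto simp: integral_unique)
    note this(1)
    also have "integral {-R..R} (\<lambda>t. g (of_real t)) = integral {-R..0} (\<lambda>t. g (of_real t)) + integral {0..R} (\<lambda>t. g (of_real t))"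
      using R0 int3 by (subst Henstock_Kurzweil_Integration.integral_combine) auto
    also have "integral {-R..0} (\<lambda>t. g (of_real t)) = integral {0..R} (\<lambda>t. g (of_real (- t)))"
      using Henstock_Kurzweil_Integration.integral_reflect_real[of R 0 "\<lambda>t. g (of_real (- t))"] by simp
    also have "integral {0..R} (\<lambda>t. g (of_real (- t))) + integral {0..R} (\<lambda>t. g (of_real t)) = integral {0..R} (\<lambda>t. g (of_real (- t)) + g (of_real t))"
    proof (rule Henstock_Kurzweil_Integration.integral_add[symmetric])
      have cont: "continuous_on A (\<lambda>t. g (of_real (s t)))" if "continuous_on A s" for A and s :: "real \<Rightarrow> real"
        using a by (intro continuous_on_compose2[OF holomorphic_on_imp_continuous_on[OF hol]] continuous_intros that) (auto simp: U_def)
      show "(\<lambda>t. g (of_real (- t))) integrable_on {0..R}" "(\<lambda>t. g (of_real t)) integrable_on {0..R}"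
        by (intro integrable_continuous_real cont continuous_intros)+
    qed
    also have "(\<lambda>t. g (of_real (- t)) + g (of_real t)) = (\<lambda>t. 2 * h t)"
    proof
      fix t :: real
      have "of_real s \<noteq> \<i> * a" for s using a by (auto simp: complex_eq_iff)
      then have "g (of_real (- t)) + g (of_real t) = (E (of_real (- t)) - E (\<i> * a)) / (of_real (- t) ^ 2 + a ^ 2) + (E (of_real t) - E (\<i> * a)) / (of_real t ^ 2 + a ^ 2)"
        using g_eq by metis
      also have "\<dots> = (E (of_real (- t)) + E (of_real t) - 2 * E (\<i> * a)) / (of_real t ^ 2 + a ^ 2)"
        by (simp add: diff_divide_distrib add_divide_distrib)
      also have "E (of_real (- t)) + E (of_real t) = 2 * of_real (cos (t * y))"
      proof -
        have "E (of_real (- t)) = cis (- (t * y))" "E (of_real t) = cis (t * y)"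
          unfolding E_def cis_conv_exp by (simp_all add: mult_ac)
        then show ?thesis by (simp add: complex_eq_iff)
      qed
      finally show "g (of_real (- t)) + g (of_real t) = 2 * h t"
        unfolding h_def Ea by (simp add: algebra_simps)
    qed
    finally have "contour_integral (linepath (of_real (- R)) (of_real R)) g = 2 * integral {0..R} h" by simp
    with sum have "2 * integral {0..R} h = - contour_integral (part_circlepath 0 R 0 pi) g"
      by (simp add: eq_neg_iff_add_eq_0)
    then have "norm (2 * integral {0..R} h) = norm (contour_integral (part_circlepath 0 R 0 pi) g)" by simp
    with arc have "2 * norm (integral {0..R} h) \<le> 2 / (R\<^sup>2 - (norm a)\<^sup>2) * R * pi" by (simp add: norm_mult)
    also have "2 / (R\<^sup>2 - (norm a)\<^sup>2) * R * pi = 2 * (pi * R / (R\<^sup>2 - (norm a)\<^sup>2))" by simp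
    finally show ?thesis by simp
  qed
  have lim0: "(\<lambda>N. integral {0..real N} h) \<longlonglongrightarrow> 0"
  proof (rule Lim_null_comparison)
    have "eventually (\<lambda>N. real N > norm a) sequentially" by real_asymp
    then show "eventually (\<lambda>N. norm (integral {0..real N} h) \<le> pi * real N / ((real N)\<^sup>2 - (norm a)\<^sup>2)) sequentially"
      by eventually_elim (rule bound)
    show "(\<lambda>N. pi * real N / ((real N)\<^sup>2 - (norm a)\<^sup>2)) \<longlonglongrightarrow> 0"
      by real_asymp
  qed
  have i1: "set_integrable lborel {0..} (\<lambda>t. of_real (cos (t * y)) / (of_real t ^ 2 + a ^ 2))"
    by (rule integrable_div_quadratic[OF a, of _ 1]) auto
  have i2: "set_integrable lborel {0..} (\<lambda>t. exp (- a * of_real y) / (of_real t ^ 2 + a ^ 2))"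
    by (rule integrable_div_quadratic[OF a]) auto
  have ih: "set_integrable lborel {0..} h"
    unfolding h_def diff_divide_distrib by (rule set_integral_diff[OF i1 i2])
  \<comment> \<open>That \<open>h\<close> integrates to 0 means that the cosine integral is exp (- a
    y) times the same integral at y = 0, so no residue has to be computed.\<close>
  have "(LBINT t:{0..}. h t) = 0"
    using LIMSEQ_unique[OF tendsto_integral_half_line[OF ih] lim0] .
  also have "(LBINT t:{0..}. h t) = (LBINT t:{0..}. of_real (cos (t * y)) / (of_real t ^ 2 + a ^ 2)) - (LBINT t:{0..}. exp (- a * of_real y) / (of_real t ^ 2 + a ^ 2))"
    unfolding h_def diff_divide_distrib by (rule set_integral_diff[OF i1 i2])
  also have "(LBINT t:{0..}. exp (- a * of_real y) / (of_real t ^ 2 + a ^ 2)) = exp (- a * of_real y) * (LBINT t:{0..}. 1 / (of_real t ^ 2 + a ^ 2))"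
    by (subst set_integral_mult_right[symmetric]) simp
  finally show ?thesis using integral_inverse_quadratic[OF a] by simp
qed

section \<open>The Mellin transform of the theta series\<close>

lemma omega_nonneg: "x > 0 \<Longrightarrow> omega x \<ge> 0"
  unfolding omega_def by (intro suminf_nonneg summable_omega) auto

text \<open>For x \<ge> 1 one has (n + 1)^2 x \<ge> n + x, so each term splits off exp (- pi x) and
  leaves a geometric term that does not depend on x.\<close>

lemma omega_le_exp:
  obtains C where "C > 0" "\<And>x. x \<ge> 1 \<Longrightarrow> omega x \<le> C * exp (- (pi * x))"
proof -
  have s: "summable (\<lambda>n. exp (- pi) ^ n)" by (rule summable_geometric) simp
  have "omega x \<le> (\<Sum>n. exp (- pi) ^ n) * exp (- (pi * x))" if x: "x \<ge> 1" for x
  proof -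
    have "exp (- (pi * real (Suc n) ^ 2 * x)) \<le> exp (- pi) ^ n * exp (- (pi * x))" for n
    proof -
      have "real n + x \<le> real (Suc n) ^ 2 * x"
      proof -
        have "real n * 1 + x \<le> real n * x + x" using x by (intro add_mono mult_left_mono) auto
        also have "\<dots> = real (Suc n) * x" by (simp add: algebra_simps)
        also have "\<dots> \<le> real (Suc n) ^ 2 * x"
          using x real_le_square_if_le[of "Suc n" "real (Suc n)"] by (intro mult_right_mono) auto
        finally show ?thesis by simp
      qed
      then have "pi * (real n + x) \<le> pi * (real (Suc n) ^ 2 * x)" by (intro mult_left_mono) auto
      then have "exp (- (pi * real (Suc n) ^ 2 * x)) \<le> exp (real n * (- pi) + - (pi * x))"
        by (simp add: algebra_simps)
      then show ?thesis by (simp only: exp_add exp_of_nat_mult)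
    qed
    then have "omega x \<le> (\<Sum>n. exp (- pi) ^ n * exp (- (pi * x)))"
      unfolding omega_def using x by (intro suminf_le summable_omega summable_mult2 s) auto
    then show ?thesis by (simp add: suminf_mult2[OF s])
  qed
  moreover have "(\<Sum>n. exp (- pi) ^ n) > (0::real)" by (rule suminf_pos[OF s]) simp
  ultimately show ?thesis using that by blast
qed

lemma omega_measurable [measurable]: "omega \<in> borel_measurable borel"
  unfolding omega_def by measurable

lemma continuous_on_omega: 
  assumes "a > 0"
  shows "continuous_on {a..b} omega"
proof -
  have "continuous_on {a..b} (\<lambda>x. \<Sum>n. exp (- (pi * real (Suc n) ^ 2 * x)))"
  proof (rule sums_integral_M_test(1))
    show "summable (\<lambda>n. exp (- (pi * real (Suc n) ^ 2 * a)))" by (rule summable_omega[OF assms])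
  qed (auto intro!: continuous_intros mult_left_mono)
  then show ?thesis by (simp add: omega_def[abs_def])
qed

text \<open>The variable \<open>y\<close> with \<open>x = exp (2 * y)\<close> turns the inversion of \<open>x\<close> into \<open>y \<mapsto> - y\<close> and
  \<open>x powr (s / 2) * dx / x\<close> into \<open>2 * exp (s * y) * dy\<close>.\<close>

definition omega_exp :: "real \<Rightarrow> real" where
  "omega_exp y = omega (exp (2 * y))"

text \<open>In the variable x this is half of Riemann's integral of omega(x) x^(s/2 - 1) over x
  \<ge> 1. Cutting at x = 1 keeps only the range of rapid decay.\<close>

definition omega_mellin :: "complex \<Rightarrow> complex" where
  "omega_mellin s = (LBINT y:{0..}. of_real (omega_exp y) * exp (s * of_real y))"

lemma omega_exp_nonneg: "omega_exp y \<ge> 0"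
  by (simp add: omega_exp_def omega_nonneg)

lemma omega_exp_measurable [measurable]: "omega_exp \<in> borel_measurable borel"
  unfolding omega_exp_def by measurable

lemma continuous_on_omega_exp: "continuous_on {a..b} omega_exp"
  unfolding omega_exp_def
  by (rule continuous_on_compose2[OF continuous_on_omega[of "exp (2 * a)" "exp (2 * b)"]])
    (auto intro!: continuous_intros)

text \<open>The theta functional equation at x = exp (2 y), where sqrt x = exp y. The elementary
  summand (exp y - 1) / 2 is the source of the terms 1 / (s - 1) and 1 / s.\<close>

lemma omega_exp_reflect: "omega_exp (- y) = (exp y - 1) / 2 + exp y * omega_exp y"
proof -
  have "sqrt (exp (2 * y)) = exp y" by (simp add: exp_double)
  moreover have "1 / exp (2 * y) = exp (2 * - y)" by (simp add: exp_minus field_simps)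
  ultimately have "1 + 2 * omega_exp y = (1 + 2 * omega_exp (- y)) / exp y"
    using theta_functional_equation[of "exp (2 * y)"] by (simp only: omega_exp_def exp_gt_zero)
  then show ?thesis by (simp add: field_simps)
qed

text \<open>Doubly exponential decay beats every exp (K y): from (K + 1) y \<le> (K + 1)^2 + y^2 and
  y^2 \<le> exp (2 y) \<le> pi exp (2 y) the exponent K y - pi exp (2 y) is at most (K + 1)^2 -
  y.\<close>

lemma omega_exp_bound:
  assumes "K \<ge> 0"
  obtains B where "B > 0" "\<And>y. y \<ge> 0 \<Longrightarrow> omega_exp y * exp (K * y) \<le> B * exp (- y)"
proof -
  obtain C where C: "C > 0" "\<And>x. x \<ge> 1 \<Longrightarrow> omega x \<le> C * exp (- (pi * x))"
    using omega_le_exp by blast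
  have "omega_exp y * exp (K * y) \<le> C * exp ((K + 1)\<^sup>2) * exp (- y)" if y: "y \<ge> 0" for y
  proof -
    have "y\<^sup>2 \<le> (exp y)\<^sup>2" using y exp_ge_add_one_self[of y] by (intro power_mono) linarith+
    also have "(exp y)\<^sup>2 = exp (2 * y)" by (simp add: exp_double)
    also have "\<dots> \<le> pi * exp (2 * y)" using pi_gt3 by simp
    finally have 1: "y\<^sup>2 \<le> pi * exp (2 * y)" .
    have "0 \<le> (K + 1 - y)\<^sup>2 + (K + 1)\<^sup>2 + y\<^sup>2" by simp
    then have 2: "(K + 1) * y \<le> (K + 1)\<^sup>2 + y\<^sup>2" by (simp add: power2_eq_square algebra_simps)
    have "omega_exp y \<le> C * exp (- (pi * exp (2 * y)))"
      unfolding omega_exp_def using y by (intro C) auto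
    then have "omega_exp y * exp (K * y) \<le> C * exp (- (pi * exp (2 * y))) * exp (K * y)"
      by (intro mult_right_mono) auto
    also have "\<dots> = C * exp (K * y - pi * exp (2 * y))" by (simp add: exp_diff exp_minus field_simps)
    also have "\<dots> \<le> C * exp ((K + 1)\<^sup>2 - y)"
      using 1 2 C(1) by (intro mult_left_mono) (auto simp: algebra_simps)
    also have "\<dots> = C * exp ((K + 1)\<^sup>2) * exp (- y)" by (simp add: exp_diff exp_minus field_simps)
    finally show ?thesis .
  qed
  then show ?thesis using C(1) by (intro that[of "C * exp ((K + 1)\<^sup>2)"]) auto
qed

lemma norm_omega_exp_bound:
  fixes s :: complex
  assumes "norm s \<le> K" "y \<ge> 0"
  shows "norm (of_real (omega_exp y) * exp (s * of_real y)) \<le> omega_exp y * exp (K * y)"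
proof -
  have "Re s * y \<le> K * y" using assms complex_Re_le_cmod[of s] by (intro mult_right_mono) auto
  then show ?thesis using omega_exp_nonneg[of y] by (auto simp: norm_mult intro!: mult_left_mono)
qed

lemma set_integrable_exp_minus:
  "set_integrable lborel {0..} (\<lambda>y. exp (- y) :: real)"
proof -
  have "set_integrable lebesgue {0..} (\<lambda>y. exp (- y) :: real)"
    using integrable_on_exp_minus_to_infinity[of 1 0]
    by (intro nonnegative_absolutely_integrable_1) auto
  then show ?thesis
    unfolding set_integrable_def by (subst (asm) integrable_completion) auto
qed

lemma set_integrable_omega_exp:
  "set_integrable lborel {0..} (\<lambda>y. of_real (omega_exp y) * exp (s * of_real y) :: complex)"
proof -
  obtain B where B: "B > 0" "\<And>y. y \<ge> 0 \<Longrightarrow> omega_exp y * exp (norm s * y) \<le> B * exp (- y)"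
    using omega_exp_bound[of "norm s"] by auto
  have "integrable lborel (\<lambda>y. B * (indicator {0..} y *\<^sub>R exp (- y)) :: real)"
    using set_integrable_exp_minus unfolding set_integrable_def by (rule integrable_mult_right)
  then show ?thesis unfolding set_integrable_def
  proof (rule Bochner_Integration.integrable_bound)
    show "AE y in lborel. norm (indicator {0..} y *\<^sub>R (of_real (omega_exp y) * exp (s * of_real y)) :: complex)
      \<le> norm (B * (indicator {0..} y *\<^sub>R exp (- y)) :: real)"
    proof (rule AE_I2)
      fix y :: real
      show "norm (indicator {0..} y *\<^sub>R (of_real (omega_exp y) * exp (s * of_real y)) :: complex)
        \<le> norm (B * (indicator {0..} y *\<^sub>R exp (- y)) :: real)"
        using B norm_omega_exp_bound[of s "norm s" y] by (fastforce simp: indicator_def)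
    qed
  qed measurable
qed

text \<open>The truncations to \<open>[0, N]\<close> are holomorphic by differentiation under the
  integral. They converge uniformly on each closed unit ball by the M-test for the integrals over
  unit intervals; \<open>K\<close> bounds the modulus on that ball, and the majorant is
  \<open>B * exp (- 1) ^ n\<close>.\<close>

lemma omega_mellin_holomorphic: "omega_mellin holomorphic_on UNIV"
proof -
  define f where "f = (\<lambda>s y. of_real (omega_exp y) * exp (s * of_real y) :: complex)"
  have cont_w: "continuous_on {a..b} (\<lambda>y. of_real (omega_exp y) :: complex)" for a b
    by (intro continuous_intros continuous_on_omega_exp)
  have cont_f: "continuous_on {a..b} (f s)" for a b s
    unfolding f_def by (intro continuous_intros cont_w)
  define F where "F = (\<lambda>N s. integral {0..real N} (f s))"
  have hol: "F N holomorphic_on UNIV" for N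
  proof -
    have "(\<lambda>s. integral (cbox 0 (real N)) (f s)) holomorphic_on UNIV"
    proof (rule leibniz_rule_holomorphic)
      show "((\<lambda>s. f s y) has_field_derivative of_real (omega_exp y) * exp (s * of_real y) * of_real y) (at s within UNIV)" for s y
        unfolding f_def by (auto intro!: derivative_eq_intros)
      show "f s integrable_on cbox 0 (real N)" for s
        using cont_f by (auto intro!: integrable_continuous_real)
      have "continuous_on (UNIV \<times> {0..real N}) (\<lambda>x. of_real (omega_exp (snd x)) :: complex)"
        by (rule continuous_on_compose2[OF cont_w]) (auto intro!: continuous_intros)
      then show "continuous_on (UNIV \<times> cbox 0 (real N)) (\<lambda>(s, y). of_real (omega_exp y) * exp (s * of_real y) * of_real y :: complex)"
        by (auto simp: case_prod_unfold intro!: continuous_intros)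
    qed auto
    then show ?thesis by (simp add: F_def)
  qed
  show ?thesis
  proof (rule holomorphic_uniform_sequence[OF open_UNIV hol])
    fix s0 :: complex
    define K where "K = norm s0 + 1"
    obtain B where B: "B > 0" "\<And>y. y \<ge> 0 \<Longrightarrow> omega_exp y * exp (K * y) \<le> B * exp (- y)"
      using omega_exp_bound[of K] by (auto simp: K_def)
    have "uniform_limit (cball s0 1) (\<lambda>N s. \<Sum>n<N. integral {real n..real (Suc n)} (f s)) 
        (\<lambda>s. \<Sum>n. integral {real n..real (Suc n)} (f s)) sequentially"
    proof (rule Weierstrass_m_test)
      show "summable (\<lambda>n. B * exp (- 1) ^ n)" by (intro summable_mult summable_geometric) simp
      fix n s assume s: "s \<in> cball s0 1"
      have "norm s \<le> K" using s norm_triangle_sub[of s s0] by (auto simp: K_def dist_norm norm_minus_commute)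
      then have fb: "norm (f s y) \<le> B * exp (- real n)" if "y \<in> {real n..real (Suc n)}" for y
      proof -
        have "norm (f s y) \<le> B * exp (- y)"
          using norm_omega_exp_bound[OF \<open>norm s \<le> K\<close>, of y] B(2)[of y] that by (auto simp: f_def)
        also have "\<dots> \<le> B * exp (- real n)" using that B(1) by auto
        finally show ?thesis .
      qed
      have "norm (integral {real n..real (Suc n)} (f s)) \<le> B * exp (- real n) * (real (Suc n) - real n)"
        using fb by (intro integral_bound cont_f) auto
      then show "norm (integral {real n..real (Suc n)} (f s)) \<le> B * exp (- 1) ^ n"
        by (simp add: exp_of_nat_mult[symmetric])
    qed
    moreover have F_eq: "(\<Sum>n<N. integral {real n..real (Suc n)} (f s)) = F N s" for N s
    proof (induction N)
      case (Suc N)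
      have "integral {0..real N} (f s) + integral {real N..real (Suc N)} (f s) = integral {0..real (Suc N)} (f s)"
        by (rule Henstock_Kurzweil_Integration.integral_combine) (auto intro!: integrable_continuous_real cont_f)
      with Suc show ?case by (simp add: F_def)
    qed (simp add: F_def)
    moreover have "(\<lambda>s. \<Sum>n. integral {real n..real (Suc n)} (f s)) = omega_mellin"
    proof
      fix s
      have "(\<lambda>N. F N s) \<longlonglongrightarrow> omega_mellin s"
        unfolding F_def omega_mellin_def f_def
        by (rule tendsto_integral_half_line[OF set_integrable_omega_exp])
      then have "(\<lambda>n. integral {real n..real (Suc n)} (f s)) sums omega_mellin s"
        by (simp only: sums_def F_eq)
      then show "(\<Sum>n. integral {real n..real (Suc n)} (f s)) = omega_mellin s" by (rule sums_unique[symmetric])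
    qed
    ultimately have "uniform_limit (cball s0 1) F omega_mellin sequentially" by simp
    then show "\<exists>d>0. cball s0 d \<subseteq> UNIV \<and> uniform_limit (cball s0 d) F omega_mellin sequentially"
      by (intro exI[of _ 1]) auto
  qed
qed

section \<open>Termwise integration against complete and incomplete gamma integrals\<close>

lemma integrable_lborel_if_lebesgue:
  fixes f :: "real \<Rightarrow> complex"
  assumes "set_integrable lebesgue S f" "S \<in> sets borel" "f \<in> borel_measurable borel"
  shows "set_integrable lborel S f"
  using assms(1) unfolding set_integrable_def
  by (subst (asm) integrable_completion) (use assms(2,3) in auto)

text \<open>The substitution u = c exp (2 y), with du = 2 u dy and u^(s/2) = c^(s/2) exp (s y). The
  set \<open>S\<close> is left open in order to treat the line, which gives the gamma function, and
  the half-line, which gives the incomplete one, at once.\<close>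

lemma Gamma_substitution:
  fixes s :: complex and c :: real
  assumes s: "Re s > 0" and c: "c > 0" and S: "S \<in> sets borel"
  defines "f \<equiv> (\<lambda>u::real. of_real u powr (s / 2 - 1) / of_real (exp u) :: complex)"
  shows "set_integrable lborel S (\<lambda>y. of_real (exp (- (c * exp (2 * y)))) * exp (s * of_real y) :: complex)"
    and "(LBINT y:S. of_real (exp (- (c * exp (2 * y)))) * exp (s * of_real y) :: complex) =
      of_real c powr (- s / 2) / 2 * integral ((\<lambda>y. c * exp (2 * y)) ` S) f"
proof -
  define g where "g = (\<lambda>y. c * exp (2 * y))"
  define F where "F = (\<lambda>y. of_real (exp (- (c * exp (2 * y)))) * exp (s * of_real y) :: complex)"
  have inj: "inj_on g S" using c by (auto simp: g_def inj_on_def)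
  have "f absolutely_integrable_on {0<..}"
    unfolding f_def using s by (intro absolutely_integrable_Gamma_integral') auto
  moreover have "g ` S \<subseteq> {0<..}" using c by (auto simp: g_def)
  \<comment> \<open>The image is described through the explicit inverse of \<open>g\<close>, as a
    preimage under a measurable function.\<close>
  moreover have "g ` S \<in> sets lebesgue"
  proof -
    have "g ` S = {u\<in>{0<..}. ln (u / c) / 2 \<in> S}"
    proof (intro set_eqI iffI)
      fix u assume "u \<in> {u\<in>{0<..}. ln (u / c) / 2 \<in> S}"
      then show "u \<in> g ` S" using c by (intro image_eqI[of _ _ "ln (u / c) / 2"]) (auto simp: g_def)
    qed (use c in \<open>auto simp: g_def\<close>)
    also have "\<dots> = (\<lambda>u. ln (u / c) / 2) -` S \<inter> space borel \<inter> {0<..}" by auto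
    also have "\<dots> \<in> sets borel" using S by measurable
    finally show ?thesis by auto
  qed
  ultimately have f: "f absolutely_integrable_on g ` S" 
    using set_integrable_subset by metis
  have "(\<lambda>y. \<bar>2 * g y\<bar> *\<^sub>R f (g y)) absolutely_integrable_on S \<and> integral S (\<lambda>y. \<bar>2 * g y\<bar> *\<^sub>R f (g y)) = integral (g ` S) f"
    using f S
    by (subst has_absolute_integral_change_of_variables_real[OF _ _ inj])
      (auto simp: g_def intro!: derivative_eq_intros)
  moreover have "\<bar>2 * g y\<bar> *\<^sub>R f (g y) = 2 * of_real c powr (s / 2) * F y" for y
  proof -
    have g0: "g y > 0" using c by (simp add: g_def)
    have "ln (g y) = ln c + 2 * y" using c by (simp add: g_def ln_mult)
    then have ln: "Ln (of_real (g y)) = Ln (of_real c) + of_real (2 * y)"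
      by (simp only: Ln_of_real[OF g0] Ln_of_real[OF c] of_real_add)
    have "of_real (g y) * of_real (g y) powr (s / 2 - 1) = (of_real (g y) powr (s / 2) :: complex)"
      using g0 by (simp add: powr_diff)
    also have "\<dots> = exp (s / 2 * (Ln (of_real c) + of_real (2 * y)))"
      using g0 ln by (simp add: powr_def)
    also have "\<dots> = of_real c powr (s / 2) * exp (s * of_real y)"
      using c by (simp add: powr_def exp_add[symmetric] algebra_simps)
    finally have *: "of_real (g y) * of_real (g y) powr (s / 2 - 1) = (of_real c powr (s / 2) * exp (s * of_real y) :: complex)" .
    have "\<bar>2 * g y\<bar> *\<^sub>R f (g y) = 2 * (of_real (g y) * of_real (g y) powr (s / 2 - 1)) * of_real (exp (- g y))"
      using g0 by (simp add: f_def scaleR_conv_of_real exp_minus field_simps)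
    also have "\<dots> = 2 * of_real c powr (s / 2) * F y"
      unfolding * by (simp add: F_def g_def)
    finally show ?thesis .
  qed
  ultimately have ai: "(\<lambda>y. 2 * of_real c powr (s / 2) * F y) absolutely_integrable_on S"
    and eq: "integral S (\<lambda>y. 2 * of_real c powr (s / 2) * F y) = integral (g ` S) f" by simp_all
  define K where "K = (2 * of_real c powr (s / 2) :: complex)"
  have K: "K \<noteq> 0" using c by (simp add: K_def)
  have "(\<lambda>y. inverse K * (K * F y)) absolutely_integrable_on S"
    by (rule set_integrable_mult_right) (use ai in \<open>simp add: K_def\<close>)
  moreover have "(\<lambda>y. inverse K * (K * F y)) = F"
    using K by (simp add: fun_eq_iff)
  ultimately have "F absolutely_integrable_on S" by simp
  then have int: "set_integrable lborel S F"
    by (rule integrable_lborel_if_lebesgue[OF _ S]) (simp add: F_def)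
  then show "set_integrable lborel S (\<lambda>y. of_real (exp (- (c * exp (2 * y)))) * exp (s * of_real y) :: complex)"
    by (simp only: F_def)
  have "K * (LBINT y:S. F y) = integral (g ` S) f"
    using eq by (simp only: set_borel_integral_eq_integral(2)[OF int] K_def[symmetric] integral_mult_right)
  moreover have "of_real c powr (- s / 2) / 2 = inverse K"
    by (simp add: K_def powr_minus)
  ultimately have "(LBINT y:S. F y) = of_real c powr (- s / 2) / 2 * integral (g ` S) f"
    using K by (simp only:) (simp add: field_simps)
  then show "(LBINT y:S. of_real (exp (- (c * exp (2 * y)))) * exp (s * of_real y) :: complex) =
      of_real c powr (- s / 2) / 2 * integral ((\<lambda>y. c * exp (2 * y)) ` S) f"
    by (simp only: F_def g_def)
qed

definition theta_term :: "nat \<Rightarrow> complex \<Rightarrow> real \<Rightarrow> complex" where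
  "theta_term n s y = of_real (exp (- (pi * real (Suc n) ^ 2 * exp (2 * y)))) * exp (s * of_real y)"

text \<open>Complex powers of products do not split in general; here all bases are positive reals,
  so the principal logarithms add.\<close>

lemma powr_pi_square:
  "of_real (pi * real (Suc n) ^ 2) powr (- s / 2) = (of_real pi powr (- s / 2) * of_nat (Suc n) powr (- s) :: complex)"
proof -
  have "Ln (of_real (pi * real (Suc n) ^ 2)) = (of_real (ln pi + 2 * ln (real (Suc n))) :: complex)"
    by (subst Ln_of_real) (auto simp: ln_mult ln_realpow)
  moreover have "Ln (of_real pi) = (of_real (ln pi) :: complex)" by (rule Ln_of_real) simp
  moreover have "Ln (of_nat (Suc n)) = (of_real (ln (real (Suc n))) :: complex)"
    using Ln_of_real[of "real (Suc n)"] by simp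
  ultimately show ?thesis
    by (simp add: powr_def exp_add[symmetric] algebra_simps del: of_nat_Suc)
qed

lemma theta_term_integrable:
  "Re s > 0 \<Longrightarrow> S \<in> sets borel \<Longrightarrow> set_integrable lborel S (theta_term n s)"
  unfolding theta_term_def[abs_def] by (rule Gamma_substitution(1)) auto

lemma theta_term_integral:
  assumes "Re s > 0"
  shows "(LBINT y. theta_term n s y) = of_real pi powr (- s / 2) / 2 * Gamma (s / 2) * of_nat (Suc n) powr (- s)"
proof -
  have im: "(\<lambda>y. pi * real (Suc n) ^ 2 * exp (2 * y)) ` UNIV = {0<..}"
  proof (intro set_eqI iffI)
    fix u :: real assume "u \<in> {0<..}"
    then show "u \<in> range (\<lambda>y. pi * real (Suc n) ^ 2 * exp (2 * y))"
      by (intro image_eqI[of _ _ "ln (u / (pi * real (Suc n) ^ 2)) / 2"]) auto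
  qed auto
  have "(LBINT y:UNIV. theta_term n s y) = of_real (pi * real (Suc n) ^ 2) powr (- s / 2) / 2 * integral {0<..} (\<lambda>u. of_real u powr (s / 2 - 1) / of_real (exp u))"
    unfolding theta_term_def by (subst Gamma_substitution(2)) (use assms im in auto)
  also have "integral {0<..} (\<lambda>u. of_real u powr (s / 2 - 1) / of_real (exp u)) = Gamma (s / 2)"
    using assms by (intro integral_unique Gamma_integral_complex') auto
  finally show ?thesis unfolding powr_pi_square by (simp add: set_lebesgue_integral_def mult_ac)
qed

text \<open>The endpoint y = 0 corresponds to u = pi (n + 1)^2, which is the lower limit of the
  incomplete gamma integral.\<close>

lemma theta_term_half_line_integral:
  assumes "Re s > 0"
  shows "(LBINT y:{0..}. theta_term n s y) = of_real pi powr (- s / 2) / 2 * (of_nat (Suc n) powr (- s) * upper_Gamma (s / 2) (pi * real (Suc n) ^ 2))"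
proof -
  define c where "c = pi * real (Suc n) ^ 2"
  have c: "c > 0" by (simp add: c_def)
  have im: "(\<lambda>y. c * exp (2 * y)) ` {0..} = {c..}"
  proof (intro set_eqI iffI)
    fix u :: real assume "u \<in> {c..}"
    then show "u \<in> (\<lambda>y. c * exp (2 * y)) ` {0..}"
      using c by (intro image_eqI[of _ _ "ln (u / c) / 2"]) auto
  qed (use c in auto)
  let ?f = "\<lambda>u::real. of_real u powr (s / 2 - 1) / of_real (exp u) :: complex"
  have "?f absolutely_integrable_on {0<..}"
    using assms by (intro absolutely_integrable_Gamma_integral') auto
  then have "?f absolutely_integrable_on {c..}"
    by (rule set_integrable_subset) (use c in auto)
  then have int: "set_integrable lborel {c..} ?f"
    by (rule integrable_lborel_if_lebesgue) auto
  have "upper_Gamma (s / 2) c = (LBINT u:{c..}. ?f u)"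
    unfolding upper_Gamma_def by (simp add: exp_minus field_simps exp_of_real)
  also have "\<dots> = integral {c..} ?f" by (rule set_borel_integral_eq_integral(2)[OF int])
  finally have uG: "integral {c..} ?f = upper_Gamma (s / 2) c" ..
  have "(LBINT y:{0..}. theta_term n s y) = of_real c powr (- s / 2) / 2 * integral {c..} ?f"
    unfolding theta_term_def c_def[symmetric] by (subst Gamma_substitution(2)) (use assms c im in auto)
  then show ?thesis unfolding uG unfolding c_def powr_pi_square by (simp add: mult_ac)
qed

text \<open>The modulus is again a term of the same kind, with a real exponent, so the integrals of
  the moduli are known in closed form.\<close>

lemma norm_theta_term: "norm (theta_term n s y) = Re (theta_term n (of_real (Re s)) y)"
proof -
  have "theta_term n (of_real (Re s)) y = of_real (exp (- (pi * real (Suc n) ^ 2 * exp (2 * y))) * exp (Re s * y))"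
    by (simp only: theta_term_def of_real_mult[symmetric] exp_of_real)
  then show ?thesis by (simp add: theta_term_def norm_mult)
qed

text \<open>Sum and integral may be exchanged because the integrals of the moduli are at most a
  constant times (n + 1)^(- Re s), which is summable as \<open>Re s > 1\<close>. Taking the line for
  \<open>S\<close> yields the zeta series, taking the half-line the incomplete gamma series.\<close>

lemma theta_term_sums:
  fixes s :: complex
  assumes s: "Re s > 1" and S: "S \<in> sets borel"
  shows "set_integrable lborel S (\<lambda>y. of_real (omega_exp y) * exp (s * of_real y) :: complex)"
    and "(\<lambda>n. LBINT y:S. theta_term n s y) sums (LBINT y:S. of_real (omega_exp y) * exp (s * of_real y))"
proof -
  let ?g = "\<lambda>n y. indicator S y *\<^sub>R theta_term n s y"
  have int: "integrable lborel (?g n)" for n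
    using theta_term_integrable[of s S n] s S by (simp add: set_integrable_def)
  have term_sums: "(\<lambda>n. theta_term n s y) sums (of_real (omega_exp y) * exp (s * of_real y))" for y
    unfolding theta_term_def omega_exp_def omega_def
    by (intro sums_mult2 sums_of_real summable_sums summable_omega) simp
  have norm_summable: "AE y in lborel. summable (\<lambda>n. norm (?g n y))"
  proof (rule AE_I2)
    fix y :: real
    have "summable (\<lambda>n. exp (- (pi * real (Suc n) ^ 2 * exp (2 * y))) * norm (exp (s * of_real y)))"
      by (intro summable_mult2 summable_omega) simp
    then show "summable (\<lambda>n. norm (?g n y))" by (auto simp: theta_term_def norm_mult indicator_def)
  qed
  have int_norm: "summable (\<lambda>n. LBINT y. norm (?g n y))"
  proof (rule summable_comparison_test'[where N=0])
    define \<sigma> where "\<sigma> = (of_real (Re s) :: complex)"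
    have \<sigma>: "Re \<sigma> > 0" using s by (simp add: \<sigma>_def)
    have i\<sigma>: "integrable lborel (theta_term n \<sigma>)" for n
      using theta_term_integrable[OF \<sigma>, of UNIV n] by (simp add: set_integrable_def)
    have "summable (\<lambda>n. real (Suc n) powr (- Re s))"
      using s summable_real_powr_iff[of "- Re s"] by (subst summable_Suc_iff) simp
    then show "summable (\<lambda>n. norm (of_real pi powr (- \<sigma> / 2) / 2 * Gamma (\<sigma> / 2)) * real (Suc n) powr (- Re s))"
      by (rule summable_mult)
    fix n
    have "norm (LBINT y. norm (?g n y)) = (LBINT y. norm (?g n y))" by simp
    also have "\<dots> \<le> (LBINT y. Re (theta_term n \<sigma> y))"
    proof (rule integral_mono)
      show "integrable lborel (\<lambda>y. norm (?g n y))" by (intro integrable_norm int)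
      show "integrable lborel (\<lambda>y. Re (theta_term n \<sigma> y))" by (intro integrable_Re i\<sigma>)
      show "norm (?g n y) \<le> Re (theta_term n \<sigma> y)" for y
        using norm_theta_term[of n s y] norm_ge_zero[of "theta_term n s y"] by (auto simp: \<sigma>_def indicator_def)
    qed
    also have "\<dots> = Re (LBINT y. theta_term n \<sigma> y)" by (rule integral_Re[OF i\<sigma>])
    also have "\<dots> \<le> norm (LBINT y. theta_term n \<sigma> y)" by (rule complex_Re_le_cmod)
    also have "\<dots> = norm (of_real pi powr (- \<sigma> / 2) / 2 * Gamma (\<sigma> / 2)) * real (Suc n) powr (- Re s)"
    proof -
      have "norm (of_nat (Suc n) powr (- \<sigma>)) = real (Suc n) powr (- Re s)"
        by (subst norm_powr_real_powr) (auto simp: \<sigma>_def)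
      then show ?thesis unfolding theta_term_integral[OF \<sigma>] by (simp only: norm_mult)
    qed
    finally show "norm (LBINT y. norm (?g n y)) \<le> norm (of_real pi powr (- \<sigma> / 2) / 2 * Gamma (\<sigma> / 2)) * real (Suc n) powr (- Re s)" .
  qed
  have suminf_g: "(\<lambda>y. \<Sum>n. ?g n y) = (\<lambda>y. indicator S y *\<^sub>R (of_real (omega_exp y) * exp (s * of_real y)))"
    by (rule ext, rule sums_unique[symmetric], rule sums_scaleR_right, rule term_sums)
  show "set_integrable lborel S (\<lambda>y. of_real (omega_exp y) * exp (s * of_real y) :: complex)"
    using integrable_suminf[OF int norm_summable int_norm]
    unfolding set_integrable_def suminf_g .
  show "(\<lambda>n. LBINT y:S. theta_term n s y) sums (LBINT y:S. of_real (omega_exp y) * exp (s * of_real y))"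
    using sums_integral[OF int norm_summable int_norm]
    unfolding set_lebesgue_integral_def suminf_g .
qed

lemma sums_upper_Gamma:
  assumes s: "Re s > 1"
  shows "of_real pi powr (- s / 2) * (\<Sum>n. of_nat (Suc n) powr (- s) * upper_Gamma (s / 2) (pi * real (Suc n) ^ 2)) = 2 * omega_mellin s"
proof -
  define p where "p = (of_real pi powr (- s / 2) / 2 :: complex)"
  have p: "p \<noteq> 0" by (simp add: p_def)
  have "(\<lambda>n. LBINT y:{0..}. theta_term n s y) sums omega_mellin s"
    unfolding omega_mellin_def by (rule theta_term_sums(2)[OF s]) simp
  also have "(\<lambda>n. LBINT y:{0..}. theta_term n s y) = (\<lambda>n. p * (of_nat (Suc n) powr (- s) * upper_Gamma (s / 2) (pi * real (Suc n) ^ 2)))"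
    unfolding p_def using s by (intro ext theta_term_half_line_integral) simp
  finally have "(\<lambda>n. of_nat (Suc n) powr (- s) * upper_Gamma (s / 2) (pi * real (Suc n) ^ 2)) sums (omega_mellin s / p)"
    using sums_mult_iff[OF p, of _ "omega_mellin s / p"] p by simp
  then show ?thesis using p by (simp add: sums_iff p_def field_simps)
qed

section \<open>Splitting the two-sided integral\<close>

lemma integral_exp_half_line:
  fixes z :: complex
  assumes z: "Re z > 0"
  shows "set_integrable lborel {0..} (\<lambda>y. exp (- z * of_real y))"
    and "(LBINT y:{0..}. exp (- z * of_real y)) = 1 / z"
proof -
  have "set_integrable lebesgue {0..} (\<lambda>y. exp (- Re z * y) :: real)"
    using integrable_on_exp_minus_to_infinity[OF z, of 0]
    by (intro nonnegative_absolutely_integrable_1) auto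
  then have "integrable lborel (\<lambda>y. indicator {0..} y *\<^sub>R exp (- Re z * y) :: real)"
    unfolding set_integrable_def by (subst (asm) integrable_completion) auto
  then show int: "set_integrable lborel {0..} (\<lambda>y. exp (- z * of_real y))"
    unfolding set_integrable_def by (rule Bochner_Integration.integrable_bound) auto
  have z0: "z \<noteq> 0" using z by auto
  have "integral {0..real N} (\<lambda>y. exp (- z * of_real y)) = 1 / z - exp (- z * of_real (real N)) / z" for N
  proof -
    have "((\<lambda>y. - exp (- z * of_real y) / z) has_vector_derivative exp (- z * of_real y)) (at y within A)" for y A
      by (rule has_vector_derivative_real_field) (use z0 in \<open>auto intro!: derivative_eq_intros\<close>)
    then have "((\<lambda>y. exp (- z * of_real y)) has_integral - exp (- z * of_real (real N)) / z - - exp (- z * of_real 0) / z) {0..real N}"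
      by (intro fundamental_theorem_of_calculus) auto
    then show ?thesis by (auto dest: integral_unique)
  qed
  moreover have "(\<lambda>N. 1 / z - exp (- z * of_real (real N)) / z) \<longlonglongrightarrow> 1 / z - 0 / z"
  proof (intro tendsto_intros z0)
    have "(\<lambda>N. exp (- Re z * real N)) \<longlonglongrightarrow> 0" using z by real_asymp
    then show "(\<lambda>N. exp (- z * of_real (real N))) \<longlonglongrightarrow> 0"
      by (intro tendsto_norm_zero_cancel[of "\<lambda>N. exp (- z * of_real (real N))"]) simp
  qed
  ultimately show "(LBINT y:{0..}. exp (- z * of_real y)) = 1 / z"
    using LIMSEQ_unique[OF tendsto_integral_half_line[OF int]] by simp
qed

lemma set_integral_Ioi_eq_Ici:
  fixes f :: "real \<Rightarrow> complex"
  assumes [measurable]: "f \<in> borel_measurable borel"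
  shows "(LBINT y:{a<..}. f y) = (LBINT y:{a..}. f y)"
  unfolding set_lebesgue_integral_def
  by (intro integral_cong_AE)
    (use AE_lborel_singleton[of a] in \<open>auto elim!: eventually_mono simp: indicator_def\<close>)

text \<open>Riemann's splitting at x = 1: the negative half-line is reflected by the functional
  equation. This returns the same kind of integral at 1 - s and two exponentials, whose integrals
  converge for \<open>Re s > 1\<close>.\<close>

lemma omega_mellin_two_sided:
  assumes s: "Re s > 1"
  shows "(LBINT y. of_real (omega_exp y) * exp (s * of_real y)) =
    omega_mellin s + omega_mellin (1 - s) + (1 / (s - 1) - 1 / s) / 2"
proof -
  let ?f = "\<lambda>y. of_real (omega_exp y) * exp (s * of_real y) :: complex"
  have "{..<0} \<union> {0..} = (UNIV :: real set)" by auto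
  then have "(LBINT y. ?f y) = (LBINT y:{..<0} \<union> {0..}. ?f y)"
    by (simp add: set_lebesgue_integral_def)
  also have "\<dots> = (LBINT y:{..<0}. ?f y) + (LBINT y:{0..}. ?f y)"
    by (intro set_integral_Un theta_term_sums(1)[OF s]) auto
  also have "(LBINT y:{..<0}. ?f y) = (LBINT y:{0<..}. ?f (- y))"
    by (subst set_integral_reflect) (simp add: greaterThan_def)
  also have "\<dots> = (LBINT y:{0..}. ?f (- y))"
    by (rule set_integral_Ioi_eq_Ici) measurable
  also have "\<dots> = (LBINT y:{0..}. (1 / 2) * (exp (- (s - 1) * of_real y) - exp (- s * of_real y)) + of_real (omega_exp y) * exp ((1 - s) * of_real y))"
  proof -
    have "?f (- y) = (1 / 2) * (exp (- (s - 1) * of_real y) - exp (- s * of_real y)) + of_real (omega_exp y) * exp ((1 - s) * of_real y)" for y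
    proof -
      have 1: "exp (of_real y) * exp (- s * of_real y) = exp ((1 - s) * of_real y)"
        by (simp add: exp_add[symmetric] algebra_simps)
      have "?f (- y) = (1 / 2) * (exp (of_real y) * exp (- s * of_real y) - exp (- s * of_real y)) + of_real (omega_exp y) * (exp (of_real y) * exp (- s * of_real y))"
        unfolding omega_exp_reflect by (simp add: algebra_simps exp_of_real diff_divide_distrib)
      then show ?thesis unfolding 1 by simp
    qed
    then show ?thesis by simp
  qed
  also have "\<dots> = (1 / 2) * (1 / (s - 1) - 1 / s) + omega_mellin (1 - s)"
  proof -
    have i1: "set_integrable lborel {0..} (\<lambda>y. exp (- (s - 1) * of_real y))"
      and i2: "set_integrable lborel {0..} (\<lambda>y. exp (- s * of_real y))"
      by (rule integral_exp_half_line(1), use s in simp)+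
    have i3: "set_integrable lborel {0..} (\<lambda>y. (1 / 2) * (exp (- (s - 1) * of_real y) - exp (- s * of_real y)))"
      by (intro set_integrable_mult_right set_integral_diff(1) i1 i2)
    have "(LBINT y:{0..}. exp (- (s - 1) * of_real y) - exp (- s * of_real y)) = 1 / (s - 1) - 1 / s"
      unfolding set_integral_diff(2)[OF i1 i2] using s by (subst (1 2) integral_exp_half_line(2)) auto
    then show ?thesis
      unfolding set_integral_add(2)[OF i3 set_integrable_omega_exp] omega_mellin_def
      by (subst set_integral_mult_right) simp
  qed
  finally show ?thesis by (simp add: omega_mellin_def algebra_simps diff_divide_distrib)
qed

section \<open>Riemann's formula and the evaluation of \<open>\<Upsilon>\<close>\<close>

text \<open>The term \<open>- rGamma (s / 2) / s\<close> is written as \<open>- rGamma (s / 2 + 1) / 2\<close>, which is holomorphic at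
  \<open>0\<close>.\<close>

definition zeta_continuation :: "complex \<Rightarrow> complex" where
  "zeta_continuation s = of_real pi powr (s / 2) *
     (rGamma (s / 2) * (1 / (s - 1) + 2 * omega_mellin s + 2 * omega_mellin (1 - s)) - rGamma (s / 2 + 1) / 2)"

lemma zeta_continuation_holomorphic: "zeta_continuation holomorphic_on (- {1})"
proof -
  have M: "(\<lambda>s. omega_mellin (h s)) holomorphic_on A" if "h holomorphic_on A" for h A
    using holomorphic_on_compose_gen[OF that omega_mellin_holomorphic] by (simp add: o_def)
  show ?thesis
    unfolding zeta_continuation_def by (intro holomorphic_intros M) auto
qed

lemma zeta_continuation_eq:
  assumes "Re s > 0"
  shows "zeta_continuation s = of_real pi powr (s / 2) * rGamma (s / 2) *
     (1 / (s - 1) - 1 / s + 2 * omega_mellin s + 2 * omega_mellin (1 - s))"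
proof -
  have s0: "s \<noteq> 0" using assms by auto
  have "rGamma (s / 2 + 1) / 2 = rGamma (s / 2) / s"
    using rGamma_plus1[of "s / 2"] s0 by (simp add: field_simps)
  then show ?thesis by (simp add: zeta_continuation_def algebra_simps)
qed

lemma pi_powr_cancel: "of_real pi powr (s / 2) * of_real pi powr (- s / 2) = (1 :: complex)"
  by (simp add: powr_minus)

text \<open>Two evaluations of the same integral over the line are compared: term by term it is
  \<open>p\<close> times the Dirichlet series, and split at 0 it is \<open>X\<close>, the bracket of
  the continuation up to the factor 2.\<close>

lemma zeta_continuation_eq_series:
  assumes s: "Re s > 1"
  shows "zeta_continuation s = (\<Sum>n. of_nat (Suc n) powr (- s))"
proof -
  define p where "p = of_real pi powr (- s / 2) / 2 * Gamma (s / 2)"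
  define X where "X = omega_mellin s + omega_mellin (1 - s) + (1 / (s - 1) - 1 / s) / 2"
  have G: "rGamma (s / 2) * Gamma (s / 2) = 1"
  proof -
    have "s / 2 \<notin> \<int>\<^sub>\<le>\<^sub>0" using s by (auto elim!: nonpos_Ints_cases simp: complex_eq_iff)
    then show ?thesis by (simp add: rGamma_inverse_Gamma Gamma_eq_zero_iff)
  qed
  then have p: "p \<noteq> 0" by (auto simp: p_def)
  have "(\<lambda>n. LBINT y:UNIV. theta_term n s y) sums (LBINT y:UNIV. of_real (omega_exp y) * exp (s * of_real y))"
    by (rule theta_term_sums(2)[OF s]) simp
  then have "(\<lambda>n. p * of_nat (Suc n) powr (- s)) sums X"
    using s theta_term_integral[of s] omega_mellin_two_sided[OF s]
    by (simp add: set_lebesgue_integral_def p_def X_def)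
  then have "(\<lambda>n. of_nat (Suc n) powr (- s)) sums (X / p)"
    using sums_mult_iff[OF p, of _ "X / p"] p by simp
  moreover have "zeta_continuation s = X / p"
  proof -
    have "zeta_continuation s * p = (of_real pi powr (s / 2) * of_real pi powr (- s / 2)) * (rGamma (s / 2) * Gamma (s / 2)) * X"
      unfolding p_def X_def by (subst zeta_continuation_eq) (use s in \<open>auto simp: algebra_simps add_divide_distrib diff_divide_distrib\<close>)
    then show ?thesis using p unfolding G pi_powr_cancel by (simp add: field_simps)
  qed
  ultimately show ?thesis by (simp add: sums_iff)
qed

text \<open>The witness \<open>zeta_continuation\<close> gives the chosen function its defining
  properties; the identity theorem on the connected punctured plane then makes the two
  equal.\<close>

lemma riemann_zeta_eq:
  assumes "s \<noteq> 1"
  shows "riemann_zeta s = zeta_continuation s"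
proof -
  define P where "P = (\<lambda>f. f holomorphic_on (- {1}) \<and> (\<forall>z. Re z > 1 \<longrightarrow> f z = (\<Sum>n. of_nat (Suc n) powr (- z))))"
  have "P zeta_continuation"
    using zeta_continuation_holomorphic zeta_continuation_eq_series by (simp add: P_def)
  then have P: "P (SOME f. P f)" by (rule someI[of P])
  have "(SOME f. P f) s = zeta_continuation s"
  proof (rule analytic_continuation_open[where s="{z. Re z > 1}" and s'="- {1}" and f="SOME f. P f"])
    show "open {z. Re z > 1}" by (rule open_halfspace_Re_gt)
    show "{z. Re z > 1} \<noteq> {}" by (auto intro!: exI[of _ 2])
    show "connected (- {1 :: complex})" by (rule connected_punctured_universe) simp
  qed (use P assms zeta_continuation_holomorphic zeta_continuation_eq_series in \<open>auto simp: P_def\<close>)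
  then show ?thesis using assms by (simp add: riemann_zeta_def P_def)
qed

text \<open>\<open>Re s > 0\<close> covers both places of use, the critical line and
  \<open>Re s > 1\<close>, and keeps s / 2 away from the poles of Gamma, where the cancellation with
  \<open>rGamma\<close> would fail.\<close>

lemma riemann_xi_eq:
  assumes s: "Re s > 0" "s \<noteq> 1"
  shows "riemann_xi s = 1 / 2 * s * (s - 1) * (1 / (s - 1) - 1 / s + 2 * omega_mellin s + 2 * omega_mellin (1 - s))"
proof -
  have "s / 2 \<notin> \<int>\<^sub>\<le>\<^sub>0" using s by (auto elim!: nonpos_Ints_cases simp: complex_eq_iff)
  then have G: "rGamma (s / 2) * Gamma (s / 2) = 1"
    by (simp add: rGamma_inverse_Gamma Gamma_eq_zero_iff)
  have "riemann_xi s = 1 / 2 * s * (s - 1) * (of_real pi powr (s / 2) * of_real pi powr (- s / 2)) * (rGamma (s / 2) * Gamma (s / 2)) *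
     (1 / (s - 1) - 1 / s + 2 * omega_mellin s + 2 * omega_mellin (1 - s))"
    unfolding riemann_xi_def riemann_zeta_eq[OF s(2)] zeta_continuation_eq[OF s(1)] by (simp only: mult_ac)
  then show ?thesis unfolding G pi_powr_cancel by simp
qed

section \<open>Integration along the critical line\<close>

definition omega_cosine :: "real \<Rightarrow> complex" where
  "omega_cosine t = (LBINT y:{0..}. of_real (omega_exp y * exp (y / 2) * cos (t * y)))"

lemma set_integrable_omega_exp_half:
  "set_integrable lborel {0..} (\<lambda>y. omega_exp y * exp (y / 2))"
proof -
  have "integrable lborel (\<lambda>y. Re (indicator {0..} y *\<^sub>R (of_real (omega_exp y) * exp (1 / 2 * of_real y))))"
    using set_integrable_omega_exp[of "1 / 2"] unfolding set_integrable_def by (rule integrable_Re)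
  then show ?thesis by (simp add: set_integrable_def Re_exp)
qed

text \<open>On the critical line s (s - 1) = - (t^2 + 1/4), and 1 - s is the conjugate of s, so the
  two Mellin integrals add up to a cosine integral. The right-hand side is written with
  \<open>(1 / 2) ^ 2\<close> to be an instance of t^2 + b^2.\<close>

lemma riemann_lambda_eq:
  "riemann_lambda t / (of_real t ^ 2 + 1 / 4) = 1 / 2 / (of_real t ^ 2 + (1 / 2) ^ 2) - 2 * omega_cosine t"
proof -
  define s where "s = 1 / 2 + \<i> * of_real t"
  have s: "Re s > 0" "s \<noteq> 1" "s \<noteq> 0" by (auto simp: s_def complex_eq_iff)
  have q: "s * (s - 1) = - (of_real t ^ 2 + 1 / 4)"
    by (simp add: s_def algebra_simps power2_eq_square)
  have q0: "of_real t ^ 2 + 1 / 4 \<noteq> (0 :: complex)"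
    using quadratic_nonzero[of "1 / 2" t] by (simp add: power_divide)
  have M: "omega_mellin s + omega_mellin (1 - s) = 2 * omega_cosine t"
  proof -
    have "omega_mellin s + omega_mellin (1 - s) = (LBINT y:{0..}. of_real (omega_exp y) * exp (s * of_real y) + of_real (omega_exp y) * exp ((1 - s) * of_real y))"
      unfolding omega_mellin_def by (rule set_integral_add(2)[OF set_integrable_omega_exp set_integrable_omega_exp, symmetric])
    also have "\<dots> = (LBINT y:{0..}. 2 * of_real (omega_exp y * exp (y / 2) * cos (t * y)))"
    proof -
      have "of_real (omega_exp y) * exp (s * of_real y) + of_real (omega_exp y) * exp ((1 - s) * of_real y) = (2 * of_real (omega_exp y * exp (y / 2) * cos (t * y)) :: complex)" for y
      proof -
        have "exp (s * of_real y) = of_real (exp (y / 2)) * cis (t * y)"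
          and "exp ((1 - s) * of_real y) = of_real (exp (y / 2)) * cis (- (t * y))"
          by (simp_all add: s_def cis_conv_exp exp_of_real[symmetric] exp_add[symmetric] algebra_simps)
        then show ?thesis by (simp add: complex_eq_iff algebra_simps)
      qed
      then show ?thesis by simp
    qed
    also have "\<dots> = 2 * omega_cosine t"
      unfolding omega_cosine_def by (subst set_integral_mult_right) simp
    finally show ?thesis .
  qed
  have "riemann_lambda t = 1 / 2 * (s * (s - 1)) * (1 / (s - 1) - 1 / s + 2 * (omega_mellin s + omega_mellin (1 - s)))"
    unfolding riemann_lambda_def s_def[symmetric] riemann_xi_eq[OF s(1,2)] by (simp add: algebra_simps)
  also have "1 / (s - 1) - 1 / s = 1 / (s * (s - 1))"
    using s by (simp add: field_simps)
  finally have "riemann_lambda t = 1 / 2 * - (of_real t ^ 2 + 1 / 4) * (1 / - (of_real t ^ 2 + 1 / 4) + 2 * (2 * omega_cosine t))"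
    unfolding q M .
  also have "\<dots> = (1 / 2 / (of_real t ^ 2 + 1 / 4) - 2 * omega_cosine t) * (of_real t ^ 2 + 1 / 4)"
  proof -
    have "1 / 2 * - Q * (1 / - Q + 2 * (2 * w)) = (1 / 2 / Q - 2 * w) * Q" if "Q \<noteq> 0" for Q w :: complex
      using that by (simp add: field_simps)
    then show ?thesis using q0 by blast
  qed
  finally show ?thesis using q0 by (simp add: power_divide)
qed

text \<open>After exchanging the integrals, the inner one produces exp (- a y), and together with
  exp (y / 2) this is the kernel of \<open>omega_mellin\<close> at 1/2 - a, which is 1 - s for a = s
  - 1/2.\<close>

lemma omega_cosine_quadratic:
  assumes a: "Re a > 0"
  shows "set_integrable lborel {0..} (\<lambda>t. omega_cosine t / (of_real t ^ 2 + a ^ 2))"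
    and "(LBINT t:{0..}. omega_cosine t / (of_real t ^ 2 + a ^ 2)) = of_real pi / (2 * a) * omega_mellin (1 / 2 - a)"
proof -
  \<comment> \<open>With the indicators inside \<open>r\<close> and \<open>q\<close>, the cosine is
    the only factor mixing the variables; as it is bounded by 1, the product of two integrable
    functions is a majorant.\<close>
  define r where "r = (\<lambda>y. indicator {0..} y * (omega_exp y * exp (y / 2)) :: real)"
  define q where "q = (\<lambda>t. indicator {0..} t / (of_real t ^ 2 + a ^ 2) :: complex)"
  define f where "f = (\<lambda>(t, y). q t * of_real (r y * cos (t * y)))"
  have r: "integrable lborel r"
    using set_integrable_omega_exp_half by (simp add: r_def set_integrable_def)
  have [measurable]: "r \<in> borel_measurable borel" "q \<in> borel_measurable borel"
    unfolding r_def q_def by measurable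
  have q: "integrable lborel q"
    using integrable_div_quadratic[OF a, of "\<lambda>_. 1" 1]
    by (simp add: q_def set_integrable_def scaleR_conv_of_real of_real_indicator)
  have f_meas [measurable]: "f \<in> borel_measurable (lborel \<Otimes>\<^sub>M lborel)"
    unfolding f_def by measurable
  have "integrable (lborel \<Otimes>\<^sub>M lborel) (\<lambda>(t, y). q t * of_real (r y))"
  proof (rule lborel_pair.Fubini_integrable)
    show "integrable lborel (\<lambda>t. LBINT y. norm (case (t, y) of (t, y) \<Rightarrow> q t * of_real (r y)))"
      using q by (simp add: norm_mult)
    show "AE t in lborel. integrable lborel (\<lambda>y. case (t, y) of (t, y) \<Rightarrow> q t * of_real (r y))"
      using r by simp
  qed measurable
  then have f_int: "integrable (lborel \<Otimes>\<^sub>M lborel) f"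
  proof (rule Bochner_Integration.integrable_bound)
    have "norm (f z) \<le> norm (case z of (t, y) \<Rightarrow> q t * of_real (r y))" for z
      using mult_left_mono[OF abs_cos_le_one, of "norm (q (fst z)) * \<bar>r (snd z)\<bar>" "fst z * snd z"]
      by (simp add: f_def case_prod_unfold norm_mult abs_mult mult_ac)
    then show "AE z in lborel \<Otimes>\<^sub>M lborel. norm (f z) \<le> norm (case z of (t, y) \<Rightarrow> q t * of_real (r y))" by simp
  qed measurable
  have inner_y: "(LBINT y. f (t, y)) = indicator {0..} t *\<^sub>R (omega_cosine t / (of_real t ^ 2 + a ^ 2))" for t
  proof -
    have "(LBINT y. f (t, y)) = q t * (LBINT y. of_real (r y * cos (t * y)))"
      unfolding f_def by simp
    also have "(LBINT y. of_real (r y * cos (t * y))) = omega_cosine t"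
      unfolding omega_cosine_def set_lebesgue_integral_def r_def
      by (intro Bochner_Integration.integral_cong) (auto simp: indicator_def)
    finally show ?thesis by (simp add: q_def indicator_def)
  qed
  have inner_t: "(LBINT t. f (t, y)) = of_real pi / (2 * a) * (indicator {0..} y *\<^sub>R (of_real (omega_exp y) * exp ((1 / 2 - a) * of_real y)))" for y
  proof (cases "y \<ge> 0")
    case True
    have "(LBINT t. f (t, y)) = (LBINT t. of_real (r y) * (indicator {0..} t *\<^sub>R (of_real (cos (t * y)) / (of_real t ^ 2 + a ^ 2))))"
      by (intro Bochner_Integration.integral_cong) (auto simp: f_def q_def indicator_def)
    also have "\<dots> = of_real (r y) * (LBINT t:{0..}. of_real (cos (t * y)) / (of_real t ^ 2 + a ^ 2))"
      by (simp only: set_lebesgue_integral_def integral_mult_right_zero)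
    also have "\<dots> = of_real (r y) * (of_real pi / (2 * a) * exp (- a * of_real y))"
      unfolding integral_cos_div_quadratic[OF a True] ..
    also have "of_real (exp (y / 2)) * exp (- a * of_real y) = exp ((1 / 2 - a) * of_real y)"
      by (simp add: exp_of_real[symmetric] exp_add[symmetric] algebra_simps)
    then have "of_real (r y) * (of_real pi / (2 * a) * exp (- a * of_real y)) = of_real pi / (2 * a) * (indicator {0..} y *\<^sub>R (of_real (omega_exp y) * exp ((1 / 2 - a) * of_real y)))"
      using True by (simp add: r_def mult_ac)
    finally show ?thesis .
  qed (simp add: f_def r_def)
  show "set_integrable lborel {0..} (\<lambda>t. omega_cosine t / (of_real t ^ 2 + a ^ 2))"
    using lborel_pair.integrable_fst[of "\<lambda>t y. f (t, y)"] f_int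
    unfolding set_integrable_def inner_y[symmetric] by simp
  have "(LBINT t:{0..}. omega_cosine t / (of_real t ^ 2 + a ^ 2)) = (LBINT t. LBINT y. f (t, y))"
    unfolding inner_y set_lebesgue_integral_def ..
  also have "\<dots> = (LBINT y. LBINT t. f (t, y))"
    using lborel_pair.Fubini_integral[of "\<lambda>t y. f (t, y)"] f_int by simp
  also have "\<dots> = of_real pi / (2 * a) * omega_mellin (1 / 2 - a)"
    unfolding inner_t omega_mellin_def set_lebesgue_integral_def integral_mult_right_zero ..
  finally show "(LBINT t:{0..}. omega_cosine t / (of_real t ^ 2 + a ^ 2)) = of_real pi / (2 * a) * omega_mellin (1 / 2 - a)" .
qed

text \<open>Partial fractions in t^2, which need \<open>a \<noteq> b\<close>; the factor a - b then
  cancels from the result. For b = 1/2 and a = s - 1/2 the sum a + b is s.\<close>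

lemma integral_product_inverse_quadratic:
  assumes a: "Re a > 0" and b: "Re b > 0" and ab: "a \<noteq> b"
  shows "set_integrable lborel {0..} (\<lambda>t. 1 / (of_real t ^ 2 + b ^ 2) / (of_real t ^ 2 + a ^ 2))"
    and "(LBINT t:{0..}. 1 / (of_real t ^ 2 + b ^ 2) / (of_real t ^ 2 + a ^ 2)) = of_real pi / (2 * a * b * (a + b))"
proof -
  have "a + b \<noteq> 0" using a b by (auto simp: complex_eq_iff)
  then have d: "a ^ 2 - b ^ 2 \<noteq> 0" using ab by (auto simp: power2_eq_square square_diff_square_factored)
  have nz: "a \<noteq> 0" "b \<noteq> 0" using a b by auto
  let ?f = "\<lambda>c t. 1 / (of_real t ^ 2 + c ^ 2) :: complex"
  have eq: "?f b t / (of_real t ^ 2 + a ^ 2) = 1 / (a ^ 2 - b ^ 2) * (?f b t - ?f a t)" for t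
  proof -
    have *: "1 / B / A = 1 / (A - B) * (1 / B - 1 / A)" if "A \<noteq> 0" "B \<noteq> 0" "A - B \<noteq> 0" for A B :: complex
      using that by (simp add: field_simps)
    show ?thesis
      using *[of "of_real t ^ 2 + a ^ 2" "of_real t ^ 2 + b ^ 2"] quadratic_nonzero[OF a] quadratic_nonzero[OF b] d by simp
  qed
  have i: "set_integrable lborel {0..} (?f a)" "set_integrable lborel {0..} (?f b)"
    by (rule integrable_div_quadratic[where B=1], use a b in auto)+
  show "set_integrable lborel {0..} (\<lambda>t. ?f b t / (of_real t ^ 2 + a ^ 2))"
    unfolding eq by (intro set_integrable_mult_right set_integral_diff(1) i)
  have "(LBINT t:{0..}. ?f b t / (of_real t ^ 2 + a ^ 2)) = 1 / (a ^ 2 - b ^ 2) * ((LBINT t:{0..}. ?f b t) - (LBINT t:{0..}. ?f a t))"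
    unfolding eq by (subst set_integral_mult_right, subst set_integral_diff(2)[OF i(2,1)]) simp
  also have "\<dots> = 1 / ((a - b) * (a + b)) * (of_real pi / (2 * b) - of_real pi / (2 * a))"
    unfolding integral_inverse_quadratic[OF a] integral_inverse_quadratic[OF b]
    by (simp add: power2_eq_square square_diff_square_factored mult.commute)
  also have "\<dots> = of_real pi / (2 * a * b * (a + b))"
    using nz ab \<open>a + b \<noteq> 0\<close> by (simp add: divide_simps) (simp add: algebra_simps)
  finally show "(LBINT t:{0..}. ?f b t / (of_real t ^ 2 + a ^ 2)) = of_real pi / (2 * a * b * (a + b))" .
qed

theorem theorem1:
  fixes s :: complex
  assumes "Re s > 1"
  shows "Upsilon s =
    of_real pi / 2 *
      (1 / (s - 1) - 2 * riemann_xi s / (s * (s - 1)) +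
       of_real pi powr (- s / 2) *
         (\<Sum>n. of_nat (Suc n) powr (- s) * upper_Gamma (s / 2) (pi * real (Suc n) ^ 2)))"
proof -
  define a where "a = s - 1 / 2"
  have "Re a > 1 / 2" using assms by (simp add: a_def)
  \<comment> \<open>\<open>Re s > 1\<close> keeps \<open>a\<close> away from 1/2, where the partial
    fractions would degenerate, and from 0.\<close>
  then have "a \<noteq> c" if "Re c \<le> 1 / 2" for c using that by auto
  from this[of "1 / 2"] this[of 0] \<open>Re a > 1 / 2\<close>
  have a: "Re a > 0" "a \<noteq> 1 / 2" "a \<noteq> 0" by auto
  have s: "s \<noteq> 0" "s \<noteq> 1" using assms by auto
  let ?g = "\<lambda>t. 1 / (of_real t ^ 2 + (1 / 2) ^ 2) / (of_real t ^ 2 + a ^ 2) :: complex"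
  let ?h = "\<lambda>t. omega_cosine t / (of_real t ^ 2 + a ^ 2)"
  have "a + 1 / 2 = s" by (simp add: a_def)
  then have g: "set_integrable lborel {0..} ?g" "(LBINT t:{0..}. ?g t) = of_real pi / (a * s)"
    using integral_product_inverse_quadratic[of a "1 / 2"] a \<open>a + 1 / 2 = s\<close> by auto
  have "Upsilon s = a * (LBINT t:{0..}. 1 / 2 * ?g t - 2 * ?h t)"
  proof -
    have "riemann_lambda t / ((of_real t ^ 2 + 1 / 4) * (of_real t ^ 2 + a ^ 2)) = 1 / 2 * ?g t - 2 * ?h t" for t
      unfolding divide_divide_eq_left[symmetric] riemann_lambda_eq by (simp add: diff_divide_distrib)
    then show ?thesis by (simp add: Upsilon_def a_def)
  qed
  also have "(LBINT t:{0..}. 1 / 2 * ?g t - 2 * ?h t) = 1 / 2 * (LBINT t:{0..}. ?g t) - 2 * (LBINT t:{0..}. ?h t)"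
  proof -
    have "set_integrable lborel {0..} (\<lambda>t. 1 / 2 * ?g t)" "set_integrable lborel {0..} (\<lambda>t. 2 * ?h t)"
      by (rule set_integrable_mult_right, rule g(1) omega_cosine_quadratic(1)[OF a(1)])+
    then show ?thesis by (simp only: set_integral_diff(2) set_integral_mult_right)
  qed
  also have "\<dots> = 1 / 2 * (of_real pi / (a * s)) - 2 * (of_real pi / (2 * a) * omega_mellin (1 - s))"
    unfolding g(2) omega_cosine_quadratic(2)[OF a(1)] by (simp add: a_def)
  also have "a * \<dots> = of_real pi / 2 * (1 / s - 2 * omega_mellin (1 - s))"
    using a s by (simp add: field_simps)
  finally have "Upsilon s = of_real pi / 2 * (1 / s - 2 * omega_mellin (1 - s))" .
  \<comment> \<open>Subtracted from 1 / (s - 1) + 2 M s, with M for \<open>omega_mellin\<close>,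
    this leaves 1 / s - 2 M (1 - s), the value found for the integral.\<close>
  moreover have "2 * riemann_xi s / (s * (s - 1)) = 1 / (s - 1) - 1 / s + 2 * omega_mellin s + 2 * omega_mellin (1 - s)"
    using s assms by (subst riemann_xi_eq) auto
  ultimately show ?thesis
    unfolding sums_upper_Gamma[OF assms] by simp
qed

end
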